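(* Let $X$ be a compact ultrametric space and let $p\in[1,+\infty)$. Then $(\mathcal{P}(X),\mathrm{W}_p^p)$ is affinely isometric to a convex subset of $\ell^1$; that is, there exists a map $\varphi:\mathcal{P}(X)\to\ell^1$ with convex image such that $$\varphi(t\mu+(1-t)\nu)=t\varphi(\mu)+(1-t)\varphi(\nu)\qquad\text{for all }\mu,\nu\in\mathcal{P}(X),\ t\in[0,1],$$ and $$\Vert\varphi(\mu)-\varphi(\nu)\Vert_1=\mathrm{W}_p(\mu,\nu)^p\qquad\text{for all }\mu,\nu\in\mathcal{P}(X).$$
   Context: An ultrametric space is a metric space $(X,d)$ with $d(x,z)\le\max(d(x,y),d(y,z))$ for all $x,y,z\in X$. $\mathcal{P}(X)$ denotes the set of Borel probability measures on the compact metric space $X$. For $p\in[1,+\infty)$ and $\mu,\nu\in\mathcal{P}(X)$, the Wasserstein distance is $$\mathrm{W}_p(\mu,\nu)=\left(\inf_{\Pi\in\Gamma(\mu,\nu)}\int_{X\times X}d(a,b)^p\,\Pi(\mathrm{d}a\,\mathrm{d}b)\right)^{1/p},$$ where $\Gamma(\mu,\nu)$ is the set of Borel probability measures on $X\times X$ with first marginal $\mu$ and second marginal $\nu$. $\ell^1$ is the space of absolutely summable real sequences with norm $\Vert\cdot\Vert_1$. *)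

theory Defs
  imports "HOL-Probability.Probability"
begin

typedef ell1 = "{a :: nat \<Rightarrow> real. summable (\<lambda>n. \<bar>a n\<bar>)}"
  morphisms coord Abs_ell1
  by (rule exI[of _ "\<lambda>_. 0"]) simp

setup_lifting type_definition_ell1

lemma summable_abs_coord: "summable (\<lambda>n. \<bar>coord a n\<bar>)"
  using coord[of a] by simp

instantiation ell1 :: real_vector
begin

lift_definition zero_ell1 :: ell1 is "\<lambda>_. 0" by simp

lift_definition plus_ell1 :: "ell1 \<Rightarrow> ell1 \<Rightarrow> ell1" is "\<lambda>a b n. a n + b n"
proof -
  fix a b :: "nat \<Rightarrow> real"
  assume "summable (\<lambda>n. \<bar>a n\<bar>)" "summable (\<lambda>n. \<bar>b n\<bar>)"
  then show "summable (\<lambda>n. \<bar>a n + b n\<bar>)"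
    by (rule summable_comparison_test'[OF summable_add, where N = 0]) simp
qed

lift_definition uminus_ell1 :: "ell1 \<Rightarrow> ell1" is "\<lambda>a n. - a n" by simp

lift_definition minus_ell1 :: "ell1 \<Rightarrow> ell1 \<Rightarrow> ell1" is "\<lambda>a b n. a n - b n"
proof -
  fix a b :: "nat \<Rightarrow> real"
  assume "summable (\<lambda>n. \<bar>a n\<bar>)" "summable (\<lambda>n. \<bar>b n\<bar>)"
  then show "summable (\<lambda>n. \<bar>a n - b n\<bar>)"
    by (rule summable_comparison_test'[OF summable_add, where N = 0]) simp
qed

lift_definition scaleR_ell1 :: "real \<Rightarrow> ell1 \<Rightarrow> ell1" is "\<lambda>r a n. r * a n"
  by (simp add: abs_mult summable_mult)

instance
  by standard (transfer; simp add: fun_eq_iff algebra_simps)+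

end

instantiation ell1 :: real_normed_vector
begin

lift_definition norm_ell1 :: "ell1 \<Rightarrow> real" is "\<lambda>a. \<Sum>n. \<bar>a n\<bar>" .

definition dist_ell1 :: "ell1 \<Rightarrow> ell1 \<Rightarrow> real"
  where "dist_ell1 a b = norm (a - b)"

definition sgn_ell1 :: "ell1 \<Rightarrow> ell1"
  where "sgn_ell1 a = a /\<^sub>R norm a"

definition uniformity_ell1 :: "(ell1 \<times> ell1) filter"
  where "uniformity_ell1 = (INF e\<in>{0<..}. principal {(a, b). dist a b < e})"

definition open_ell1 :: "ell1 set \<Rightarrow> bool"
  where "open_ell1 U \<longleftrightarrow> (\<forall>a\<in>U. eventually (\<lambda>(a', b). a' = a \<longrightarrow> b \<in> U) uniformity)"

instance
proof
  fix a b :: ell1 and r :: real and U :: "ell1 set"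
  show "dist a b = norm (a - b)" by (rule dist_ell1_def)
  show "sgn a = a /\<^sub>R norm a" by (rule sgn_ell1_def)
  show "uniformity = (INF e\<in>{0<..}. principal {(a, b :: ell1). dist a b < e})"
    by (rule uniformity_ell1_def)
  show "open U \<longleftrightarrow> (\<forall>a\<in>U. eventually (\<lambda>(a', b). a' = a \<longrightarrow> b \<in> U) uniformity)"
    by (rule open_ell1_def)
  show "norm a = 0 \<longleftrightarrow> a = 0"
    by transfer (auto simp: suminf_eq_zero_iff)
  show "norm (a + b) \<le> norm a + norm b"
  proof transfer
    fix a b :: "nat \<Rightarrow> real"
    assume a: "summable (\<lambda>n. \<bar>a n\<bar>)" and b: "summable (\<lambda>n. \<bar>b n\<bar>)"
    have le: "\<bar>a n + b n\<bar> \<le> \<bar>a n\<bar> + \<bar>b n\<bar>" for n by (rule abs_triangle_ineq)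
    have "summable (\<lambda>n. \<bar>a n + b n\<bar>)"
      by (rule summable_comparison_test'[OF summable_add[OF a b], of 0]) (use le in auto)
    then have "(\<Sum>n. \<bar>a n + b n\<bar>) \<le> (\<Sum>n. \<bar>a n\<bar> + \<bar>b n\<bar>)"
      by (intro suminf_le le summable_add a b)
    also have "\<dots> = (\<Sum>n. \<bar>a n\<bar>) + (\<Sum>n. \<bar>b n\<bar>)"
      by (rule suminf_add[OF a b, symmetric])
    finally show "(\<Sum>n. \<bar>a n + b n\<bar>) \<le> (\<Sum>n. \<bar>a n\<bar>) + (\<Sum>n. \<bar>b n\<bar>)" .
  qed
  show "norm (r *\<^sub>R a) = \<bar>r\<bar> * norm a"
    by transfer (simp add: abs_mult suminf_mult)
qed

end

definition ultrametric_on :: "'a :: metric_space set \<Rightarrow> bool"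
  where "ultrametric_on X \<longleftrightarrow>
    (\<forall>x\<in>X. \<forall>y\<in>X. \<forall>z\<in>X. dist x z \<le> max (dist x y) (dist y z))"

text \<open>The trace sigma-algebra on \<open>X\<close> is the Borel sigma-algebra of \<open>X\<close> with its subspace topology.\<close>

definition prob_measures :: "'a :: topological_space set \<Rightarrow> 'a measure set"
  where "prob_measures X = {\<mu>. prob_space \<mu> \<and> sets \<mu> = sets (restrict_space borel X)}"

definition couplings ::
    "'a :: topological_space set \<Rightarrow> 'a measure \<Rightarrow> 'a measure \<Rightarrow> ('a \<times> 'a) measure set"
  where "couplings X \<mu> \<nu> = {\<gamma> \<in> prob_measures (X \<times> X).
    distr \<gamma> (restrict_space borel X) fst = \<mu> \<and> distr \<gamma> (restrict_space borel X) snd = \<nu>}"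

text \<open>For compact \<open>X\<close> the cost is continuous and bounded, hence integrable against every coupling,
  and \<^term>\<open>couplings X \<mu> \<nu>\<close> contains the product measure, so the real-valued infimum is a genuine one.\<close>

definition wasserstein ::
    "'a :: metric_space set \<Rightarrow> real \<Rightarrow> 'a measure \<Rightarrow> 'a measure \<Rightarrow> real"
  where "wasserstein X p \<mu> \<nu> =
    (INF \<gamma>\<in>couplings X \<mu> \<nu>. \<integral>(a, b). dist a b powr p \<partial>\<gamma>) powr (1 / p)"

text \<open>This is \<open>t \<mu> + (1 - t) \<nu>\<close>, meaningful only when \<open>sets \<mu> = sets \<nu>\<close> and \<open>0 \<le> t \<le> 1\<close>.\<close>

definition mix_measure :: "real \<Rightarrow> 'a measure \<Rightarrow> 'a measure \<Rightarrow> 'a measure"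
  where "mix_measure t \<mu> \<nu> = measure_of (space \<mu>) (sets \<mu>)
    (\<lambda>A. ennreal t * emeasure \<mu> A + ennreal (1 - t) * emeasure \<nu> A)"

lemma sets_mix_measure [simp]: "sets (mix_measure t \<mu> \<nu>) = sets \<mu>"
  by (simp add: mix_measure_def sets.sigma_sets_eq sets.space_closed)

lemma space_mix_measure [simp]: "space (mix_measure t \<mu> \<nu>) = space \<mu>"
  by (rule sets_eq_imp_space_eq) simp

lemma emeasure_mix_measure:
  assumes "sets \<mu> = sets \<nu>" and "A \<in> sets \<mu>"
  shows "emeasure (mix_measure t \<mu> \<nu>) A = ennreal t * emeasure \<mu> A + ennreal (1 - t) * emeasure \<nu> A"
  unfolding mix_measure_def
proof (rule emeasure_measure_of_sigma[OF sets.sigma_algebra_axioms _ _ assms(2)])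
  show "positive (sets \<mu>) (\<lambda>A. ennreal t * emeasure \<mu> A + ennreal (1 - t) * emeasure \<nu> A)"
    by (simp add: positive_def)
  show "countably_additive (sets \<mu>) (\<lambda>A. ennreal t * emeasure \<mu> A + ennreal (1 - t) * emeasure \<nu> A)"
  proof (rule countably_additiveI)
    fix B :: "nat \<Rightarrow> 'a set"
    assume B: "range B \<subseteq> sets \<mu>" "disjoint_family B"
    have "(\<Sum>i. ennreal t * emeasure \<mu> (B i) + ennreal (1 - t) * emeasure \<nu> (B i)) =
        ennreal t * (\<Sum>i. emeasure \<mu> (B i)) + ennreal (1 - t) * (\<Sum>i. emeasure \<nu> (B i))"
      by (simp add: suminf_add[symmetric])
    also have "\<dots> = ennreal t * emeasure \<mu> (\<Union>i. B i) + ennreal (1 - t) * emeasure \<nu> (\<Union>i. B i)"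
      using B assms(1) by (simp add: suminf_emeasure)
    finally show "(\<Sum>i. ennreal t * emeasure \<mu> (B i) + ennreal (1 - t) * emeasure \<nu> (B i)) =
        ennreal t * emeasure \<mu> (\<Union>i. B i) + ennreal (1 - t) * emeasure \<nu> (\<Union>i. B i)" .
  qed
qed

lemma mix_measure_in_prob_measures:
  assumes "\<mu> \<in> prob_measures X" "\<nu> \<in> prob_measures X" "0 \<le> t" "t \<le> 1"
  shows "mix_measure t \<mu> \<nu> \<in> prob_measures X"
proof -
  have s: "sets \<mu> = sets \<nu>" and p: "prob_space \<mu>" "prob_space \<nu>"
    using assms by (auto simp: prob_measures_def)
  have "emeasure (mix_measure t \<mu> \<nu>) (space \<mu>) = ennreal t + ennreal (1 - t)"
    using emeasure_mix_measure[OF s sets.top, of t] p[THEN prob_space.emeasure_space_1]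
    by (simp add: sets_eq_imp_space_eq[OF s])
  also have "\<dots> = 1"
    using assms by (simp add: ennreal_plus[symmetric] del: ennreal_plus)
  finally have "prob_space (mix_measure t \<mu> \<nu>)"
    by (intro prob_spaceI) simp
  then show ?thesis
    using assms by (simp add: prob_measures_def)
qed

end

theory Submission
  imports Defs
begin

text \<open>In an ultrametric space the open balls of a fixed radius partition the space, and for compact
  \<open>X\<close> the nonzero distances can be listed in a sequence \<open>r\<close> strictly decreasing to \<open>0\<close>.
  Telescoping gives \<open>d(x, y)\<^sup>p = (\<Sum>k | r k \<le> d(x, y). r k\<^sup>p - r (k+1)\<^sup>p)\<close>, so the cost of a coupling
  is the weighted sum of the masses it moves between different balls of radius \<open>r k\<close>. At each
  scale this mass is at least half of \<open>\<Sum>\<bar>\<mu> B - \<nu> B\<bar>\<close> over the balls \<open>B\<close>. Matching as much mass as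
  possible first inside the smallest balls, then inside the next larger ones, and so on, attains
  these bounds simultaneously at the first \<open>K\<close> scales, and the remaining scales cost at most
  \<open>r K\<^sup>p\<close>. Hence the weighted masses \<open>(r k\<^sup>p - r (k+1)\<^sup>p) / 2 \<cdot> \<mu> B\<close> are the
  coordinates of the embedding. Stopping at finite \<open>K\<close> avoids any compactness argument for
  couplings.\<close>

section \<open>Listing the positive distances as a decreasing null sequence\<close>

text \<open>Adjoining all \<open>1 / real (Suc n)\<close> gives a set without a least element, even
  if \<open>U\<close> is finite, and still leaves only finitely many elements above any positive
  bound. Passing repeatedly to the next smaller element then never stops and misses nothing. The
  price is that \<open>r\<close> may also take values outside \<open>U\<close>.\<close>

lemma ex_decreasing_enumeration:
  fixes U :: "real set"
  assumes fin: "\<And>e. 0 < e \<Longrightarrow> finite {u\<in>U. e \<le> u}" and pos: "\<And>u. u \<in> U \<Longrightarrow> 0 < u"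
  shows "\<exists>r. (\<forall>k. 0 < r k) \<and> (\<forall>k. r (Suc k) < r k) \<and> r \<longlonglongrightarrow> 0 \<and> U \<subseteq> range r"
proof -
  define W where "W = U \<union> range (\<lambda>n::nat. 1 / real (Suc n))"
  have W_pos: "0 < w" if "w \<in> W" for w
    using that pos by (auto simp: W_def)
  have W_fin: "finite {w\<in>W. e \<le> w}" if "0 < e" for e
  proof -
    have "{n. e \<le> 1 / real (Suc n)} \<subseteq> {..nat \<lceil>1 / e\<rceil>}"
    proof
      fix n assume "n \<in> {n. e \<le> 1 / real (Suc n)}"
      then have "real (Suc n) \<le> 1 / e"
        using that by (simp add: field_simps)
      then show "n \<in> {..nat \<lceil>1 / e\<rceil>}" by (simp add: le_nat_iff) linarith
    qed
    then have "finite ((\<lambda>n. 1 / real (Suc n)) ` {n. e \<le> 1 / real (Suc n)})"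
      using finite_subset by blast
    moreover have "{w\<in>W. e \<le> w} = {u\<in>U. e \<le> u} \<union> (\<lambda>n. 1 / real (Suc n)) ` {n. e \<le> 1 / real (Suc n)}"
      by (auto simp: W_def)
    ultimately show ?thesis using fin[OF that] by simp
  qed
  have W_below: "\<exists>w\<in>W. w < e" if "0 < e" for e :: real
    using reals_Archimedean[OF that] by (auto simp: W_def inverse_eq_divide)
  \<comment> \<open>A next smaller element exists: some \<open>w0\<close> in \<open>W\<close> lies
    below \<open>x\<close>, and between \<open>w0\<close> and \<open>x\<close> there are only
    finitely many candidates.\<close>
  have step: "\<exists>w\<in>W. w < x \<and> (\<forall>u\<in>W. u < x \<longrightarrow> u \<le> w)" if "0 < x" for x
  proof -
    obtain w0 where w0: "w0 \<in> W" "w0 < x" using W_below[OF \<open>0 < x\<close>] by auto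
    define F where "F = {w\<in>W. w0 \<le> w \<and> w < x}"
    have "finite F"
      by (rule finite_subset[OF _ W_fin[of w0]]) (use w0 W_pos in \<open>auto simp: F_def\<close>)
    moreover have "w0 \<in> F" using w0 by (simp add: F_def)
    ultimately have "Max F \<in> F" "\<And>u. u \<in> F \<Longrightarrow> u \<le> Max F"
      using Max_in by auto
    then show ?thesis
      using \<open>w0 \<in> F\<close> by (intro bexI[of _ "Max F"]) (force simp: F_def not_le)+
  qed
  have "bdd_above W"
  proof -
    show ?thesis
      using bdd_above_finite[OF W_fin[of 1]] by (auto simp: bdd_above_def) (metis linear order_trans)
  qed
  \<comment> \<open>Starting strictly above \<open>W\<close> makes \<open>r 0\<close> the largest
    element of \<open>W\<close>.\<close>
  then obtain M where M: "\<And>w. w \<in> W \<Longrightarrow> w < M" "0 < M"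
    by (auto simp: bdd_above_def) (metis W_below W_pos gt_ex less_trans order.strict_trans1 zero_less_one)
  define nxt where "nxt x = (SOME w. w \<in> W \<and> w < x \<and> (\<forall>u\<in>W. u < x \<longrightarrow> u \<le> w))" for x
  have nxt: "nxt x \<in> W \<and> nxt x < x \<and> (\<forall>u\<in>W. u < x \<longrightarrow> u \<le> nxt x)" if "0 < x" for x
    unfolding nxt_def by (rule someI_ex) (use step[OF that] in blast)
  define r where "r k = (nxt ^^ Suc k) M" for k
  have r0: "r 0 = nxt M" and rS: "r (Suc k) = nxt (r k)" for k by (simp_all add: r_def)
  have rW: "r k \<in> W" for k
    by (induction k) (use nxt W_pos M in \<open>auto simp: r0 rS\<close>)
  have r_pos: "0 < r k" for k using rW W_pos by blast
  have dec: "r (Suc k) < r k" for k using nxt[OF r_pos] by (simp add: rS)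
  have "inj r"
    using lift_Suc_mono_less[of "\<lambda>k. - r k"] dec by (metis injI neg_less_iff_less neq_iff)
  have "r \<longlonglongrightarrow> 0"
  proof (rule order_tendstoI)
    fix a :: real assume "0 < a"
    have "finite (r -` {w\<in>W. a \<le> w})"
      by (rule finite_vimageI[OF W_fin[OF \<open>0 < a\<close>] \<open>inj r\<close>])
    then have "\<forall>\<^sub>F k in cofinite. \<not> a \<le> r k"
      using rW by (simp add: vimage_def eventually_cofinite)
    then show "\<forall>\<^sub>F k in sequentially. r k < a"
      by (simp add: cofinite_eq_sequentially not_le)
  next
    fix a :: real assume "a < 0"
    then show "\<forall>\<^sub>F k in sequentially. a < r k" using r_pos less_trans by (intro always_eventually) blast
  qed
  moreover have "U \<subseteq> range r"
  proof (rule ccontr)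
    assume "\<not> U \<subseteq> range r"
    then obtain u where u: "u \<in> U" "u \<in> W" "\<And>k. u \<noteq> r k" by (auto simp: W_def)
    \<comment> \<open>By maximality at each step, a value that is never listed stays below every
      \<open>r k\<close>, so it cannot be positive.\<close>
    have "u < r k" for k
    proof (induction k)
      case 0 then show ?case using nxt[OF M(2)] M(1) u r0 by (metis order_le_less)
    next
      case (Suc k) then show ?case using nxt[OF r_pos] u rS by (metis order_le_less)
    qed
    then have "u \<le> 0" using \<open>r \<longlonglongrightarrow> 0\<close> by (intro LIMSEQ_le_const) (auto intro: less_imp_le)
    then show False using pos u by fastforce
  qed
  ultimately show ?thesis using r_pos dec by blast
qed

subsection \<open>Greedy transport plans on a finite tree\<close>

text \<open>One step of the greedy matching: inside each block of \<open>q\<close>, the residual masses left over by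
  \<open>\<pi>\<^sub>0\<close> are matched by their normalised product (which is \<open>0\<close>, by \<open>x / 0 = 0\<close>, when both are exhausted).\<close>

lemma match_residuals:
  fixes m n :: "'i \<Rightarrow> real" and q :: "'i \<Rightarrow> 'b" and \<pi>\<^sub>0 :: "'i \<Rightarrow> 'i \<Rightarrow> real"
  assumes fin: "finite J"
    and row: "\<forall>i\<in>J. (\<Sum>j\<in>J. \<pi>\<^sub>0 i j) \<le> m i"
    and col: "\<forall>j\<in>J. (\<Sum>i\<in>J. \<pi>\<^sub>0 i j) \<le> n j"
    and supp: "\<forall>i\<in>J. \<forall>j\<in>J. q i \<noteq> q j \<longrightarrow> \<pi>\<^sub>0 i j = 0"
  shows "\<exists>\<pi>. (\<forall>i\<in>J. \<forall>j\<in>J. \<pi>\<^sub>0 i j \<le> \<pi> i j) \<and>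
    (\<forall>i\<in>J. (\<Sum>j\<in>J. \<pi> i j) \<le> m i) \<and> (\<forall>j\<in>J. (\<Sum>i\<in>J. \<pi> i j) \<le> n j) \<and>
    (\<forall>i\<in>J. \<forall>j\<in>J. q i \<noteq> q j \<longrightarrow> \<pi> i j = 0) \<and>
    (\<forall>b. min (\<Sum>i | i \<in> J \<and> q i = b. m i) (\<Sum>j | j \<in> J \<and> q j = b. n j)
           \<le> (\<Sum>i | i \<in> J \<and> q i = b. \<Sum>j | j \<in> J \<and> q j = b. \<pi> i j))"
proof -
  define u where "u i = m i - (\<Sum>j\<in>J. \<pi>\<^sub>0 i j)" for i
  define v where "v j = n j - (\<Sum>i\<in>J. \<pi>\<^sub>0 i j)" for j
  define J\<^sub>b where "J\<^sub>b b = {i \<in> J. q i = b}" for b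
  define U where "U b = (\<Sum>i\<in>J\<^sub>b b. u i)" for b
  define V where "V b = (\<Sum>i\<in>J\<^sub>b b. v i)" for b
  \<comment> \<open>Dividing by the larger residual total keeps row sums below \<open>u\<close> and
    column sums below \<open>v\<close>, while the block total becomes exactly the smaller residual
    total.\<close>
  define a where "a i j = (if q i = q j then u i * v j / max (U (q i)) (V (q i)) else 0)" for i j
  have u: "0 \<le> u i" and v: "0 \<le> v i" if "i \<in> J" for i
    using row col that by (auto simp: u_def v_def)
  have U: "0 \<le> U b" and V: "0 \<le> V b" for b
    by (auto simp: U_def V_def J\<^sub>b_def intro!: sum_nonneg u v)
  have a: "0 \<le> a i j" if "i \<in> J" "j \<in> J" for i j
    using that u v U V by (auto simp: a_def le_max_iff_disj)
  have frac: "x * s / t \<le> x" if "0 \<le> x" "s \<le> t" "0 \<le> s" for x s t :: real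
    using that mult_left_mono[of s t x] by (cases "t = 0") (auto simp: field_simps)
  have row_a: "(\<Sum>j\<in>J. a i j) \<le> u i" if "i \<in> J" for i
  proof -
    have "(\<Sum>j\<in>J. a i j) = (\<Sum>j\<in>J\<^sub>b (q i). u i * v j / max (U (q i)) (V (q i)))"
      unfolding J\<^sub>b_def a_def using fin by (subst sum.inter_filter) (auto intro!: sum.cong)
    also have "\<dots> = u i * V (q i) / max (U (q i)) (V (q i))"
      by (simp add: V_def sum_distrib_left sum_divide_distrib)
    also have "\<dots> \<le> u i" by (rule frac) (use u that V in auto)
    finally show ?thesis .
  qed
  have col_a: "(\<Sum>i\<in>J. a i j) \<le> v j" if "j \<in> J" for j
  proof -
    have "(\<Sum>i\<in>J. a i j) = (\<Sum>i\<in>J\<^sub>b (q j). v j * u i / max (U (q j)) (V (q j)))"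
      unfolding J\<^sub>b_def a_def using fin by (subst sum.inter_filter) (auto intro!: sum.cong)
    also have "\<dots> = v j * U (q j) / max (U (q j)) (V (q j))"
      by (simp add: U_def sum_distrib_left sum_divide_distrib)
    also have "\<dots> \<le> v j" by (rule frac) (use v that U in auto)
    finally show ?thesis .
  qed
  show ?thesis
  proof (intro exI[of _ "\<lambda>i j. \<pi>\<^sub>0 i j + a i j"] conjI ballI allI impI)
    show "\<pi>\<^sub>0 i j \<le> \<pi>\<^sub>0 i j + a i j" if "i \<in> J" "j \<in> J" for i j using a that by simp
    show "(\<Sum>j\<in>J. \<pi>\<^sub>0 i j + a i j) \<le> m i" if "i \<in> J" for i
      using row_a[OF that] by (simp add: sum.distrib u_def)
    show "(\<Sum>i\<in>J. \<pi>\<^sub>0 i j + a i j) \<le> n j" if "j \<in> J" for j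
      using col_a[OF that] by (simp add: sum.distrib v_def)
    show "\<pi>\<^sub>0 i j + a i j = 0" if "i \<in> J" "j \<in> J" "q i \<noteq> q j" for i j
      using that supp by (simp add: a_def)
    fix b
    have "(\<Sum>i\<in>J\<^sub>b b. \<Sum>j\<in>J\<^sub>b b. a i j) = (\<Sum>i\<in>J\<^sub>b b. \<Sum>j\<in>J\<^sub>b b. u i * v j) / max (U b) (V b)"
      by (simp add: a_def J\<^sub>b_def sum_divide_distrib)
    also have "\<dots> = U b * V b / max (U b) (V b)"
      by (simp add: U_def V_def sum_product)
    also have "\<dots> = min (U b) (V b)"
      using U[of b] V[of b] by (auto simp: max_def min_def)
    finally have 1: "(\<Sum>i\<in>J\<^sub>b b. \<Sum>j\<in>J\<^sub>b b. a i j) = min (U b) (V b)" .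
    have "(\<Sum>j\<in>J\<^sub>b b. \<pi>\<^sub>0 i j) = (\<Sum>j\<in>J. \<pi>\<^sub>0 i j)" if "i \<in> J\<^sub>b b" for i
      by (rule sum.mono_neutral_left) (use that supp fin in \<open>(force simp: J\<^sub>b_def)+\<close>)
    then have 2: "(\<Sum>i\<in>J\<^sub>b b. \<Sum>j\<in>J\<^sub>b b. \<pi>\<^sub>0 i j) = (\<Sum>i\<in>J\<^sub>b b. m i) - U b"
      by (simp add: U_def u_def sum_subtractf)
    have "(\<Sum>i\<in>J\<^sub>b b. \<pi>\<^sub>0 i j) = (\<Sum>i\<in>J. \<pi>\<^sub>0 i j)" if "j \<in> J\<^sub>b b" for j
      by (rule sum.mono_neutral_left) (use that supp fin in \<open>(force simp: J\<^sub>b_def)+\<close>)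
    then have 3: "(\<Sum>i\<in>J\<^sub>b b. \<Sum>j\<in>J\<^sub>b b. \<pi>\<^sub>0 i j) = (\<Sum>j\<in>J\<^sub>b b. n j) - V b"
      by (subst sum.swap) (simp add: V_def v_def sum_subtractf)
    \<comment> \<open>Facts 2 and 3 say that both residual totals arise by subtracting the same mass
      already placed in the block. Adding \<open>min (U b) (V b)\<close> to that mass therefore
      gives the minimum of the two block masses.\<close>
    show "min (\<Sum>i | i \<in> J \<and> q i = b. m i) (\<Sum>j | j \<in> J \<and> q j = b. n j)
           \<le> (\<Sum>i | i \<in> J \<and> q i = b. \<Sum>j | j \<in> J \<and> q j = b. \<pi>\<^sub>0 i j + a i j)"
      using 1 2 3 by (simp add: sum.distrib J\<^sub>b_def[symmetric])
  qed
qed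

text \<open>Induction from the finest level downwards, starting with the zero plan at
  \<open>Suc K\<close>. Refinement keeps the old plan supported inside the coarser blocks of level
  \<open>k\<close>, so \<open>match_residuals\<close> applies there. It only adds mass, hence the
  bounds already reached at finer levels survive.\<close>

lemma ex_hierarchical_subplan:
  fixes m n :: "'i \<Rightarrow> real" and q :: "nat \<Rightarrow> 'i \<Rightarrow> 'b"
  assumes fin: "finite J" and m: "\<forall>i\<in>J. 0 \<le> m i" and n: "\<forall>i\<in>J. 0 \<le> n i"
    and refine: "\<forall>k. \<forall>i\<in>J. \<forall>j\<in>J. q (Suc k) i = q (Suc k) j \<longrightarrow> q k i = q k j"
    and "k \<le> Suc K"
  shows "\<exists>\<pi>. (\<forall>i\<in>J. \<forall>j\<in>J. 0 \<le> \<pi> i j) \<and>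
    (\<forall>i\<in>J. (\<Sum>j\<in>J. \<pi> i j) \<le> m i) \<and> (\<forall>j\<in>J. (\<Sum>i\<in>J. \<pi> i j) \<le> n j) \<and>
    (\<forall>i\<in>J. \<forall>j\<in>J. q k i \<noteq> q k j \<longrightarrow> \<pi> i j = 0) \<and>
    (\<forall>l\<in>{k..K}. \<forall>b. min (\<Sum>i | i \<in> J \<and> q l i = b. m i) (\<Sum>j | j \<in> J \<and> q l j = b. n j)
           \<le> (\<Sum>i | i \<in> J \<and> q l i = b. \<Sum>j | j \<in> J \<and> q l j = b. \<pi> i j))"
  using \<open>k \<le> Suc K\<close>
proof (induction k rule: inc_induct)
  case base
  show ?case by (rule exI[of _ "\<lambda>_ _. 0"]) (use m n in simp)
next
  case (step k)
  obtain \<pi>\<^sub>0 where \<pi>\<^sub>0: "\<forall>i\<in>J. \<forall>j\<in>J. 0 \<le> \<pi>\<^sub>0 i j"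
    "\<forall>i\<in>J. (\<Sum>j\<in>J. \<pi>\<^sub>0 i j) \<le> m i" "\<forall>j\<in>J. (\<Sum>i\<in>J. \<pi>\<^sub>0 i j) \<le> n j"
    "\<forall>i\<in>J. \<forall>j\<in>J. q (Suc k) i \<noteq> q (Suc k) j \<longrightarrow> \<pi>\<^sub>0 i j = 0"
    and blk: "\<forall>l\<in>{Suc k..K}. \<forall>b.
      min (\<Sum>i | i \<in> J \<and> q l i = b. m i) (\<Sum>j | j \<in> J \<and> q l j = b. n j)
           \<le> (\<Sum>i | i \<in> J \<and> q l i = b. \<Sum>j | j \<in> J \<and> q l j = b. \<pi>\<^sub>0 i j)"
    using step.IH by (elim exE conjE) (rule that)
  have supp: "\<forall>i\<in>J. \<forall>j\<in>J. q k i \<noteq> q k j \<longrightarrow> \<pi>\<^sub>0 i j = 0"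
    using \<pi>\<^sub>0(4) refine by blast
  obtain \<pi> where \<pi>: "\<forall>i\<in>J. \<forall>j\<in>J. \<pi>\<^sub>0 i j \<le> \<pi> i j"
    "\<forall>i\<in>J. (\<Sum>j\<in>J. \<pi> i j) \<le> m i" "\<forall>j\<in>J. (\<Sum>i\<in>J. \<pi> i j) \<le> n j"
    "\<forall>i\<in>J. \<forall>j\<in>J. q k i \<noteq> q k j \<longrightarrow> \<pi> i j = 0"
    "\<forall>b. min (\<Sum>i | i \<in> J \<and> q k i = b. m i) (\<Sum>j | j \<in> J \<and> q k j = b. n j)
           \<le> (\<Sum>i | i \<in> J \<and> q k i = b. \<Sum>j | j \<in> J \<and> q k j = b. \<pi> i j)"
    using match_residuals[of J \<pi>\<^sub>0 m n "q k", OF fin \<pi>\<^sub>0(2,3) supp]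
    by (elim exE conjE) (rule that)
  show ?case
  proof (intro exI[of _ \<pi>] conjI ballI allI impI)
    fix l b assume l: "l \<in> {k..K}"
    show "min (\<Sum>i | i \<in> J \<and> q l i = b. m i) (\<Sum>j | j \<in> J \<and> q l j = b. n j)
           \<le> (\<Sum>i | i \<in> J \<and> q l i = b. \<Sum>j | j \<in> J \<and> q l j = b. \<pi> i j)"
    proof (cases "l = k")
      case False
      then have "l \<in> {Suc k..K}" using l by auto
      then show ?thesis
        by (intro order_trans[OF blk[rule_format]] sum_mono \<pi>(1)[rule_format]) auto
    qed (use \<pi>(5) in auto)
  next
    show "0 \<le> \<pi> i j" if "i \<in> J" "j \<in> J" for i j
      using \<pi>(1) \<pi>\<^sub>0(1) that by (meson order_trans)
  qed (use \<pi>(2-4) in auto)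
qed

text \<open>At level 0 all indices form one block, whose bound forces the plan to carry the full
  mass. Since the two totals agree, no row or column inequality can be strict.\<close>

lemma ex_hierarchical_plan:
  fixes m n :: "'i \<Rightarrow> real" and q :: "nat \<Rightarrow> 'i \<Rightarrow> 'b"
  assumes fin: "finite J" and m: "\<forall>i\<in>J. 0 \<le> m i" and n: "\<forall>i\<in>J. 0 \<le> n i"
    and refine: "\<forall>k. \<forall>i\<in>J. \<forall>j\<in>J. q (Suc k) i = q (Suc k) j \<longrightarrow> q k i = q k j"
    and root: "\<forall>i\<in>J. \<forall>j\<in>J. q 0 i = q 0 j"
    and eq: "sum m J = sum n J"
  shows "\<exists>\<pi>. (\<forall>i\<in>J. \<forall>j\<in>J. 0 \<le> \<pi> i j) \<and>
    (\<forall>i\<in>J. (\<Sum>j\<in>J. \<pi> i j) = m i) \<and> (\<forall>j\<in>J. (\<Sum>i\<in>J. \<pi> i j) = n j) \<and>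
    (\<forall>l\<le>K. \<forall>b. min (\<Sum>i | i \<in> J \<and> q l i = b. m i) (\<Sum>j | j \<in> J \<and> q l j = b. n j)
           \<le> (\<Sum>i | i \<in> J \<and> q l i = b. \<Sum>j | j \<in> J \<and> q l j = b. \<pi> i j))"
proof -
  obtain \<pi> where *: "(\<forall>i\<in>J. \<forall>j\<in>J. 0 \<le> \<pi> i j) \<and>
    (\<forall>i\<in>J. (\<Sum>j\<in>J. \<pi> i j) \<le> m i) \<and> (\<forall>j\<in>J. (\<Sum>i\<in>J. \<pi> i j) \<le> n j) \<and>
    (\<forall>i\<in>J. \<forall>j\<in>J. q 0 i \<noteq> q 0 j \<longrightarrow> \<pi> i j = 0) \<and>
    (\<forall>l\<in>{0..K}. \<forall>b. min (\<Sum>i | i \<in> J \<and> q l i = b. m i) (\<Sum>j | j \<in> J \<and> q l j = b. n j)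
           \<le> (\<Sum>i | i \<in> J \<and> q l i = b. \<Sum>j | j \<in> J \<and> q l j = b. \<pi> i j))"
    using ex_hierarchical_subplan[of J m n q 0 K, OF fin m n refine le0] ..
  note \<pi> = *[THEN conjunct1] *[THEN conjunct2, THEN conjunct1]
    *[THEN conjunct2, THEN conjunct2, THEN conjunct1]
  note blk = *[THEN conjunct2, THEN conjunct2, THEN conjunct2, THEN conjunct2]
  have tot: "sum m J \<le> (\<Sum>i\<in>J. \<Sum>j\<in>J. \<pi> i j)"
  proof (cases "J = {}")
    case False
    then obtain i where i: "i \<in> J" by auto
    have J: "{j. j \<in> J \<and> q 0 j = q 0 i} = J" using root i by blast
    have "min (sum m J) (sum n J) \<le> (\<Sum>i\<in>J. \<Sum>j\<in>J. \<pi> i j)"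
      using bspec[OF blk, of 0, THEN spec, of "q 0 i"] unfolding J by simp
    then show ?thesis unfolding eq by simp
  qed simp
  have le: "(\<Sum>i\<in>J. \<Sum>j\<in>J. \<pi> i j) \<le> sum m J"
    by (rule sum_mono) (use \<pi>(2) in auto)
  have row: "(\<Sum>j\<in>J. \<pi> i j) = m i" if "i \<in> J" for i
    by (rule sum_mono_inv[OF antisym[OF le tot] _ that fin]) (use \<pi>(2) in auto)
  have "(\<Sum>j\<in>J. \<Sum>i\<in>J. \<pi> i j) = sum n J"
    using antisym[OF le tot] eq by (subst sum.swap) simp
  then have col: "(\<Sum>i\<in>J. \<pi> i j) = n j" if "j \<in> J" for j
    by (rule sum_mono_inv[OF _ _ that fin]) (use \<pi>(3) in auto)
  show ?thesis
    by (rule exI[of _ \<pi>]) (use \<pi>(1) row col blk in \<open>simp del: min_le_iff_disj\<close>)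
qed

subsection \<open>Couplings from finite transport plans\<close>

lemma measure_eq_sum_partition:
  assumes "finite_measure M" and "finite J" and "\<And>i. i \<in> J \<Longrightarrow> B i \<in> sets M"
    and "disjoint_family_on B J" and "space M \<subseteq> (\<Union>i\<in>J. B i)" and "A \<in> sets M"
  shows "measure M A = (\<Sum>i\<in>J. measure M (A \<inter> B i))"
proof -
  interpret finite_measure M by fact
  have "A = (\<Union>i\<in>J. A \<inter> B i)"
    using assms(5) sets.sets_into_space[OF assms(6)] by blast
  moreover have "measure M (\<Union>i\<in>J. A \<inter> B i) = (\<Sum>i\<in>J. measure M (A \<inter> B i))"
    by (rule finite_measure_finite_Union)
      (use assms in \<open>auto simp: disjoint_family_on_def\<close>)
  ultimately show ?thesis by simp
qed

text \<open>The mass \<open>\<pi> i j\<close> is spread over \<open>B i \<times> B j\<close> as the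
  product of the conditional measures of \<open>\<mu>\<close> on \<open>B i\<close> and
  \<open>\<nu>\<close> on \<open>B j\<close>. Assumption \<open>id\<close> lets a measure on the
  product sigma-algebra be read as one on the Borel sets of \<open>X \<times> X\<close>.\<close>

lemma ex_coupling_of_plan:
  fixes X :: "'a :: topological_space set" and B :: "'i \<Rightarrow> 'a set" and \<pi> :: "'i \<Rightarrow> 'i \<Rightarrow> real"
  assumes id: "(\<lambda>z. z) \<in> restrict_space borel X \<Otimes>\<^sub>M restrict_space borel X \<rightarrow>\<^sub>M restrict_space borel (X \<times> X)"
    and \<mu>: "\<mu> \<in> prob_measures X" and \<nu>: "\<nu> \<in> prob_measures X"
    and fin: "finite J" and B: "\<forall>i\<in>J. B i \<in> sets (restrict_space borel X)"
    and disj: "disjoint_family_on B J" and cover: "X \<subseteq> (\<Union>i\<in>J. B i)"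
    and pos: "\<forall>i\<in>J. \<forall>j\<in>J. 0 \<le> \<pi> i j"
    and row: "\<forall>i\<in>J. (\<Sum>j\<in>J. \<pi> i j) = measure \<mu> (B i)"
    and col: "\<forall>j\<in>J. (\<Sum>i\<in>J. \<pi> i j) = measure \<nu> (B j)"
  shows "\<exists>\<gamma>\<in>couplings X \<mu> \<nu>.
    \<forall>A\<in>sets (restrict_space borel X). \<forall>C\<in>sets (restrict_space borel X).
      measure \<gamma> (A \<times> C) = (\<Sum>i\<in>J. \<Sum>j\<in>J. \<pi> i j *
        (measure \<mu> (A \<inter> B i) / measure \<mu> (B i)) * (measure \<nu> (C \<inter> B j) / measure \<nu> (B j)))"
proof -
  note B = B[rule_format] and pos = pos[rule_format] and row = row[rule_format] and col = col[rule_format]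
  let ?R = "restrict_space borel X" and ?RR = "restrict_space borel (X \<times> X)"
  interpret \<mu>: prob_space \<mu> using \<mu> by (simp add: prob_measures_def)
  interpret \<nu>: prob_space \<nu> using \<nu> by (simp add: prob_measures_def)
  have s: "sets \<mu> = sets ?R" "sets \<nu> = sets ?R"
    using \<mu> \<nu> by (auto simp: prob_measures_def)
  have sp: "space \<mu> = X" "space \<nu> = X"
    using s[THEN sets_eq_imp_space_eq] by (simp_all add: space_restrict_space)
  have sX: "X \<in> sets ?R"
    using sets.top[of ?R] by (simp add: space_restrict_space)
  have pair: "sets (\<mu> \<Otimes>\<^sub>M \<nu>) = sets (?R \<Otimes>\<^sub>M ?R)"
    using s by (rule sets_pair_measure_cong)
  define h where "h z = (\<Sum>i\<in>J. \<Sum>j\<in>J. ennreal (\<pi> i j / (measure \<mu> (B i) * measure \<nu> (B j))) *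
    indicator (B i \<times> B j) z)" for z
  define S where "S A C = (\<Sum>i\<in>J. \<Sum>j\<in>J. \<pi> i j *
        (measure \<mu> (A \<inter> B i) / measure \<mu> (B i)) * (measure \<nu> (C \<inter> B j) / measure \<nu> (B j)))" for A C
  define M where "M = density (\<mu> \<Otimes>\<^sub>M \<nu>) h"
  \<comment> \<open>Pushing forward along the identity changes only the sigma-algebra, from the
    product one to the Borel one that \<open>couplings\<close> asks for.\<close>
  define \<gamma> where "\<gamma> = distr M ?RR (\<lambda>z. z)"
  have BB: "B i \<times> B j \<in> sets (\<mu> \<Otimes>\<^sub>M \<nu>)" if "i \<in> J" "j \<in> J" for i j
    using B that s by (intro pair_measureI) auto
  have h: "h \<in> borel_measurable (\<mu> \<Otimes>\<^sub>M \<nu>)"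
    unfolding h_def by (intro borel_measurable_sum borel_measurable_times_ennreal
      borel_measurable_const borel_measurable_indicator BB)
  have idM: "(\<lambda>z. z) \<in> M \<rightarrow>\<^sub>M ?RR"
    using id by (subst measurable_cong_sets[OF _ refl]) (auto simp: M_def pair)
  have times: "A \<times> C \<in> sets ?RR" if AC: "A \<in> sets ?R" "C \<in> sets ?R" for A C
  proof -
    have ex: "\<exists>A'\<in>sets borel. A = X \<inter> A'" if "A \<in> sets ?R" for A
      using that by (simp add: sets_restrict_space image_iff)
    obtain A' C' where A': "A = X \<inter> A'" "A' \<in> sets borel" and C': "C = X \<inter> C'" "C' \<in> sets borel"
      using ex[OF AC(1)] ex[OF AC(2)] by blast
    have "A \<times> C = (X \<times> X) \<inter> (A' \<times> C')" using A' C' by blast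
    then show ?thesis
      unfolding sets_restrict_space by (rule image_eqI) (intro borel_Times A' C')
  qed
  have eM: "emeasure M (A \<times> C) = ennreal (S A C)" if AC: "A \<in> sets ?R" "C \<in> sets ?R" for A C
  proof -
    have "emeasure M (A \<times> C) = (\<integral>\<^sup>+z. h z * indicator (A \<times> C) z \<partial>(\<mu> \<Otimes>\<^sub>M \<nu>))"
      unfolding M_def by (rule emeasure_density[OF h]) (use that s in auto)
    also have "\<dots> = (\<integral>\<^sup>+z. (\<Sum>i\<in>J. \<Sum>j\<in>J. ennreal (\<pi> i j / (measure \<mu> (B i) * measure \<nu> (B j))) *
        indicator ((A \<inter> B i) \<times> (C \<inter> B j)) z) \<partial>(\<mu> \<Otimes>\<^sub>M \<nu>))"
      unfolding h_def sum_distrib_right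
      by (intro nn_integral_cong sum.cong refl) (auto simp: indicator_def)
    also have "\<dots> = (\<Sum>i\<in>J. \<Sum>j\<in>J. ennreal (\<pi> i j / (measure \<mu> (B i) * measure \<nu> (B j))) *
        emeasure (\<mu> \<Otimes>\<^sub>M \<nu>) ((A \<inter> B i) \<times> (C \<inter> B j)))"
    proof -
      have mes: "(A \<inter> B i) \<times> (C \<inter> B j) \<in> sets (\<mu> \<Otimes>\<^sub>M \<nu>)" if "i \<in> J" "j \<in> J" for i j
        using AC B[OF that(1)] B[OF that(2)] s by (intro pair_measureI) auto
      show ?thesis
      proof (subst nn_integral_sum)
        fix i assume i: "i \<in> J"
        show "(\<lambda>z. \<Sum>j\<in>J. ennreal (\<pi> i j / (measure \<mu> (B i) * measure \<nu> (B j))) *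
            indicator ((A \<inter> B i) \<times> (C \<inter> B j)) z) \<in> borel_measurable (\<mu> \<Otimes>\<^sub>M \<nu>)"
          by (intro borel_measurable_sum borel_measurable_times_ennreal
            borel_measurable_const borel_measurable_indicator mes i)
      next
        show "(\<Sum>i\<in>J. \<integral>\<^sup>+z. (\<Sum>j\<in>J. ennreal (\<pi> i j / (measure \<mu> (B i) * measure \<nu> (B j))) *
            indicator ((A \<inter> B i) \<times> (C \<inter> B j)) z) \<partial>(\<mu> \<Otimes>\<^sub>M \<nu>)) =
          (\<Sum>i\<in>J. \<Sum>j\<in>J. ennreal (\<pi> i j / (measure \<mu> (B i) * measure \<nu> (B j))) *
            emeasure (\<mu> \<Otimes>\<^sub>M \<nu>) ((A \<inter> B i) \<times> (C \<inter> B j)))"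
          by (intro sum.cong refl, subst nn_integral_sum)
            (intro borel_measurable_times_ennreal borel_measurable_const borel_measurable_indicator mes
              sum.cong refl nn_integral_cmult_indicator; assumption)+
      qed
    qed
    also have "\<dots> = (\<Sum>i\<in>J. \<Sum>j\<in>J. ennreal (\<pi> i j *
        (measure \<mu> (A \<inter> B i) / measure \<mu> (B i)) * (measure \<nu> (C \<inter> B j) / measure \<nu> (B j))))"
    proof (intro sum.cong refl)
      fix i j assume ij: "i \<in> J" "j \<in> J"
      have "emeasure (\<mu> \<Otimes>\<^sub>M \<nu>) ((A \<inter> B i) \<times> (C \<inter> B j)) =
          ennreal (measure \<mu> (A \<inter> B i) * measure \<nu> (C \<inter> B j))"
        using that B ij s
        by (subst \<nu>.emeasure_pair_measure_Times)
          (auto simp: \<mu>.emeasure_eq_measure \<nu>.emeasure_eq_measure ennreal_mult)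
      then show "ennreal (\<pi> i j / (measure \<mu> (B i) * measure \<nu> (B j))) *
          emeasure (\<mu> \<Otimes>\<^sub>M \<nu>) ((A \<inter> B i) \<times> (C \<inter> B j)) = ennreal (\<pi> i j *
          (measure \<mu> (A \<inter> B i) / measure \<mu> (B i)) * (measure \<nu> (C \<inter> B j) / measure \<nu> (B j)))"
        using pos[OF ij] by (simp add: ennreal_mult[symmetric] mult_ac)
    qed
    also have "\<dots> = ennreal (S A C)"
      unfolding S_def using pos by (simp add: sum_ennreal sum_nonneg)
    finally show ?thesis .
  qed
  have e: "emeasure \<gamma> (A \<times> C) = ennreal (S A C)" if "A \<in> sets ?R" "C \<in> sets ?R" for A C
  proof -
    have "A \<times> C \<subseteq> space M"
      using that s sp by (auto simp: M_def space_pair_measure dest!: sets.sets_into_space)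
        (auto simp: space_restrict_space)
    then show ?thesis
      using eM[OF that] times[OF that] unfolding \<gamma>_def
      by (subst emeasure_distr[OF idM]) (auto simp: Int_absorb2)
  qed
  \<comment> \<open>Over a null cell the nonnegative entries of the row or column sum to 0. This
    makes the convention \<open>x / 0 = 0\<close> give the right values below.\<close>
  have \<pi>0: "\<pi> i j = 0" if "i \<in> J" "j \<in> J" "measure \<mu> (B i) = 0 \<or> measure \<nu> (B j) = 0" for i j
    using that(3)
  proof
    assume "measure \<mu> (B i) = 0"
    then show ?thesis using row[OF that(1)] pos that fin by (auto simp: sum_nonneg_eq_0_iff)
  next
    assume "measure \<nu> (B j) = 0"
    then show ?thesis using col[OF that(2)] pos that fin by (auto simp: sum_nonneg_eq_0_iff)
  qed
  have fst_S: "S A X = measure \<mu> A" if A: "A \<in> sets ?R" for A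
  proof -
    have "S A X = (\<Sum>i\<in>J. \<Sum>j\<in>J. \<pi> i j * (measure \<mu> (A \<inter> B i) / measure \<mu> (B i)))"
      unfolding S_def
    proof (intro sum.cong refl)
      fix i j assume ij: "i \<in> J" "j \<in> J"
      have "X \<inter> B j = B j" using B[OF ij(2)] sets.sets_into_space by (fastforce simp: space_restrict_space)
      then show "\<pi> i j * (measure \<mu> (A \<inter> B i) / measure \<mu> (B i)) * (measure \<nu> (X \<inter> B j) / measure \<nu> (B j))
        = \<pi> i j * (measure \<mu> (A \<inter> B i) / measure \<mu> (B i))"
        using \<pi>0[OF ij] by auto
    qed
    also have "\<dots> = (\<Sum>i\<in>J. measure \<mu> (A \<inter> B i))"
    proof (intro sum.cong refl)
      fix i assume i: "i \<in> J"
      have "measure \<mu> (A \<inter> B i) \<le> measure \<mu> (B i)"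
        by (rule \<mu>.finite_measure_mono) (use B[OF i] s in auto)
      then show "(\<Sum>j\<in>J. \<pi> i j * (measure \<mu> (A \<inter> B i) / measure \<mu> (B i))) = measure \<mu> (A \<inter> B i)"
        unfolding sum_distrib_right[symmetric] row[OF i]
        using measure_nonneg[of \<mu> "A \<inter> B i"] by (cases "measure \<mu> (B i) = 0") auto
    qed
    also have "\<dots> = measure \<mu> A"
      by (rule measure_eq_sum_partition[symmetric, OF \<mu>.finite_measure_axioms fin _ disj])
        (use B A s sp cover in auto)
    finally show ?thesis .
  qed
  have snd_S: "S X C = measure \<nu> C" if C: "C \<in> sets ?R" for C
  proof -
    have "S X C = (\<Sum>j\<in>J. \<Sum>i\<in>J. \<pi> i j * (measure \<nu> (C \<inter> B j) / measure \<nu> (B j)))"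
      unfolding S_def
    proof (subst sum.swap, intro sum.cong refl)
      fix i j assume ij: "i \<in> J" "j \<in> J"
      have "X \<inter> B i = B i" using B[OF ij(1)] sets.sets_into_space by (fastforce simp: space_restrict_space)
      then show "\<pi> i j * (measure \<mu> (X \<inter> B i) / measure \<mu> (B i)) * (measure \<nu> (C \<inter> B j) / measure \<nu> (B j))
        = \<pi> i j * (measure \<nu> (C \<inter> B j) / measure \<nu> (B j))"
        using \<pi>0[OF ij] by auto
    qed
    also have "\<dots> = (\<Sum>j\<in>J. measure \<nu> (C \<inter> B j))"
    proof (intro sum.cong refl)
      fix j assume j: "j \<in> J"
      have "measure \<nu> (C \<inter> B j) \<le> measure \<nu> (B j)"
        by (rule \<nu>.finite_measure_mono) (use B[OF j] s in auto)
      then show "(\<Sum>i\<in>J. \<pi> i j * (measure \<nu> (C \<inter> B j) / measure \<nu> (B j))) = measure \<nu> (C \<inter> B j)"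
        unfolding sum_distrib_right[symmetric] col[OF j]
        using measure_nonneg[of \<nu> "C \<inter> B j"] by (cases "measure \<nu> (B j) = 0") auto
    qed
    also have "\<dots> = measure \<nu> C"
      by (rule measure_eq_sum_partition[symmetric, OF \<nu>.finite_measure_axioms fin _ disj])
        (use B C s sp cover in auto)
    finally show ?thesis .
  qed
  have sp\<gamma>: "space \<gamma> = X \<times> X" and sets\<gamma>: "sets \<gamma> = sets ?RR"
    by (simp_all add: \<gamma>_def space_restrict_space)
  have mfst: "fst \<in> \<gamma> \<rightarrow>\<^sub>M ?R" and msnd: "snd \<in> \<gamma> \<rightarrow>\<^sub>M ?R"
    unfolding measurable_cong_sets[OF sets\<gamma> refl]
    by (auto intro!: measurable_restrict_space3 borel_measurable_continuous_onI continuous_intros)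
  have "prob_space \<gamma>"
    by (rule prob_spaceI) (use e[OF sX sX] fst_S[OF sX] \<mu>.prob_space sp in \<open>simp add: sp\<gamma>\<close>)
  moreover have "distr \<gamma> ?R fst = \<mu>"
  proof (rule measure_eqI)
    fix A assume "A \<in> sets (distr \<gamma> ?R fst)"
    then have A: "A \<in> sets ?R" by simp
    then have "A \<subseteq> X" using sets.sets_into_space by (fastforce simp: space_restrict_space)
    then have "fst -` A \<inter> space \<gamma> = A \<times> X" by (auto simp: sp\<gamma>)
    then show "emeasure (distr \<gamma> ?R fst) A = emeasure \<mu> A"
      using e[OF A sX] fst_S[OF A] by (simp add: emeasure_distr[OF mfst A] \<mu>.emeasure_eq_measure)
  qed (simp add: s)
  moreover have "distr \<gamma> ?R snd = \<nu>"
  proof (rule measure_eqI)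
    fix A assume "A \<in> sets (distr \<gamma> ?R snd)"
    then have A: "A \<in> sets ?R" by simp
    then have "A \<subseteq> X" using sets.sets_into_space by (fastforce simp: space_restrict_space)
    then have "snd -` A \<inter> space \<gamma> = X \<times> A" by (auto simp: sp\<gamma>)
    then show "emeasure (distr \<gamma> ?R snd) A = emeasure \<nu> A"
      using e[OF sX A] snd_S[OF A] by (simp add: emeasure_distr[OF msnd A] \<nu>.emeasure_eq_measure)
  qed (simp add: s)
  ultimately have "\<gamma> \<in> couplings X \<mu> \<nu>"
    using sets\<gamma> by (simp add: couplings_def prob_measures_def)
  moreover have "measure \<gamma> (A \<times> C) = S A C" if "A \<in> sets ?R" "C \<in> sets ?R" for A C
  proof -
    have "0 \<le> S A C" unfolding S_def using pos by (auto intro!: sum_nonneg)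
    then show ?thesis using e[OF that] by (simp add: measure_def)
  qed
  ultimately show ?thesis unfolding S_def by blast
qed

subsection \<open>Partitions into balls\<close>

locale compact_ultrametric =
  fixes X :: "'a :: metric_space set"
  assumes compact: "compact X" and ultrametric: "ultrametric_on X"
begin

lemma dist_le: "x \<in> X \<Longrightarrow> y \<in> X \<Longrightarrow> z \<in> X \<Longrightarrow> dist x z \<le> dist x y \<or> dist x z \<le> dist y z"
  using ultrametric unfolding ultrametric_on_def le_max_iff_disj by blast

text \<open>The balls are open, so that two points lie in different cells exactly when their
  distance is at least \<open>r\<close>.\<close>

definition cell :: "real \<Rightarrow> 'a \<Rightarrow> 'a set"
  where "cell r x = X \<inter> ball x r"

definition cells :: "real \<Rightarrow> 'a set set"
  where "cells r = cell r ` X"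

lemma mem_cell_self: "x \<in> X \<Longrightarrow> 0 < r \<Longrightarrow> x \<in> cell r x"
  by (simp add: cell_def)

text \<open>In an ultrametric space every point of an open ball is a centre of it.\<close>

lemma cell_eq_iff:
  assumes "x \<in> X" "y \<in> X" "0 < r"
  shows "cell r x = cell r y \<longleftrightarrow> dist x y < r"
proof
  assume "cell r x = cell r y"
  then show "dist x y < r"
    using mem_cell_self[OF assms(2,3)] by (auto simp: cell_def)
next
  assume "dist x y < r"
  moreover have "cell r a \<subseteq> cell r b" if "a \<in> X" "b \<in> X" "dist a b < r" for a b
  proof
    fix z assume "z \<in> cell r a"
    then show "z \<in> cell r b"
      using dist_le[of b a z] that by (auto simp: cell_def dist_commute)
  qed
  ultimately show "cell r x = cell r y"
    using assms by (simp add: dist_commute subset_antisym)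
qed

lemma mem_cells:
  assumes "B \<in> cells r" "x \<in> B" "0 < r"
  shows "x \<in> X" "B = cell r x"
proof -
  obtain y where y: "y \<in> X" "B = cell r y" using assms by (auto simp: cells_def)
  show "x \<in> X" using y assms by (simp add: cell_def)
  then show "B = cell r x" using y assms cell_eq_iff by (auto simp: cell_def)
qed

lemma disjoint_cells: "0 < r \<Longrightarrow> disjoint_family_on (\<lambda>B. B) (cells r)"
  unfolding disjoint_family_on_def using mem_cells by blast

lemma Union_cells: "0 < r \<Longrightarrow> \<Union>(cells r) = X"
  by (auto simp: cells_def cell_def)

lemma finite_net:
  assumes "0 < r"
  obtains C where "finite C" "C \<subseteq> X" "\<forall>x\<in>X. \<exists>c\<in>C. dist x c < r"
proof -
  have "X \<subseteq> (\<Union>c\<in>X. ball c r)" using assms by auto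
  then obtain C where "C \<subseteq> X" "finite C" "X \<subseteq> (\<Union>c\<in>C. ball c r)"
    using compactE_image[OF compact, of X "\<lambda>c. ball c r"] by auto
  then show thesis using that[of C] by (auto simp: dist_commute subset_iff)
qed

text \<open>By compactness there is a finite net of mesh \<open>r\<close>, and each cell can be
  recentred at a net point.\<close>

lemma finite_cells:
  assumes "0 < r" shows "finite (cells r)"
proof -
  obtain C where C: "finite C" "C \<subseteq> X" "\<forall>x\<in>X. \<exists>c\<in>C. dist x c < r"
    using finite_net[OF assms] .
  have "cells r \<subseteq> cell r ` C"
  proof
    fix B assume "B \<in> cells r"
    then obtain x where x: "x \<in> X" "B = cell r x" by (auto simp: cells_def)
    then obtain c where c: "c \<in> C" "dist x c < r" using C(3) by blast
    then have "B = cell r c" using x C(2) cell_eq_iff[of x c r] assms by auto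
    then show "B \<in> cell r ` C" using c by blast
  qed
  then show ?thesis using C(1) finite_surj by blast
qed

lemma sets_cells: "B \<in> cells r \<Longrightarrow> B \<in> sets (restrict_space borel X)"
  unfolding cells_def cell_def sets_restrict_space by (elim imageE) (auto intro: borel_open)

text \<open>Moving the endpoints of a pair by less than \<open>e\<close> does not change a distance
  that is at least \<open>e\<close>, since ultrametric triangles are isosceles. Every such distance
  is thus already attained between two points of a finite net.\<close>

lemma finite_dist_ge:
  assumes "0 < e"
  shows "finite {d \<in> (\<lambda>(x, y). dist x y) ` (X \<times> X). e \<le> d}"
proof -
  obtain C where C: "finite C" "C \<subseteq> X" "\<forall>x\<in>X. \<exists>c\<in>C. dist x c < e"
    using finite_net[OF assms] .
  have "{d \<in> (\<lambda>(x, y). dist x y) ` (X \<times> X). e \<le> d} \<subseteq> (\<lambda>(x, y). dist x y) ` (C \<times> C)"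
  proof
    fix v assume "v \<in> {d \<in> (\<lambda>(x, y). dist x y) ` (X \<times> X). e \<le> d}"
    then obtain x y where xy: "x \<in> X" "y \<in> X" "e \<le> dist x y" and v: "v = dist x y" by auto
    obtain c d where cd: "c \<in> C" "d \<in> C" "dist x c < e" "dist y d < e" using C(3) xy by meson
    then have X: "c \<in> X" "d \<in> X" using C(2) by auto
    have "dist x y = dist c d"
      using dist_le[OF xy(1) X(1) xy(2)] dist_le[OF X xy(2)] dist_le[OF X(1) xy(1) X(2)]
        dist_le[OF xy(1,2) X(2)] xy(3) cd(3,4) dist_commute[of c x] dist_commute[of d y]
      by (elim disjE) linarith+
    then show "v \<in> (\<lambda>(x, y). dist x y) ` (C \<times> C)" using cd v by auto
  qed
  then show ?thesis using C(1) finite_subset by blast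
qed

text \<open>Without a countable base on the whole type, Borel sets of the product need not lie in the product
  sigma-algebra; on \<open>X\<close> the balls of radius \<open>1 / n\<close> provide one.\<close>

lemma measurable_id_pair:
  "(\<lambda>z. z) \<in> restrict_space borel X \<Otimes>\<^sub>M restrict_space borel X \<rightarrow>\<^sub>M restrict_space borel (X \<times> X)"
    (is "_ \<in> ?P \<rightarrow>\<^sub>M _")
proof (rule measurable_restrict_space2)
  show "(\<lambda>z. z) \<in> space ?P \<rightarrow> X \<times> X" by (auto simp: space_pair_measure space_restrict_space)
  show "(\<lambda>z. z) \<in> borel_measurable ?P"
  proof (rule borel_measurableI)
    fix S :: "('a \<times> 'a) set" assume "open S"
    \<comment> \<open>For each \<open>n\<close> there are finitely many products of cells inside
      \<open>S\<close>, so their union over all \<open>n\<close> is a countable union of measurable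
      rectangles.\<close>
    define D where "D n = {(B, C). B \<in> cells (1 / real (Suc n)) \<and> C \<in> cells (1 / real (Suc n)) \<and> B \<times> C \<subseteq> S}" for n
    have "finite (D n)" for n
      by (rule finite_subset[of _ "cells (1 / real (Suc n)) \<times> cells (1 / real (Suc n))"])
        (auto simp: D_def intro!: finite_cells)
    then have "(\<Union>n. \<Union>(B, C)\<in>D n. B \<times> C) \<in> sets ?P"
      by (intro sets.countable_UN'' sets.finite_UN) (auto simp: D_def intro!: pair_measureI sets_cells)
    moreover have "S \<inter> X \<times> X = (\<Union>n. \<Union>(B, C)\<in>D n. B \<times> C)"
    proof (intro equalityI subsetI)
      fix z assume "z \<in> S \<inter> X \<times> X"
      then obtain x y where z: "z = (x, y)" "(x, y) \<in> S" "x \<in> X" "y \<in> X" by auto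
      obtain U V where UV: "open U" "open V" "(x, y) \<in> U \<times> V" "U \<times> V \<subseteq> S"
        using open_prod_elim[OF \<open>open S\<close> z(2)] .
      obtain e where e: "0 < e" "ball x e \<subseteq> U" using UV openE by blast
      obtain f where f: "0 < f" "ball y f \<subseteq> V" using UV openE by blast
      obtain n where "inverse (real (Suc n)) < min e f"
        using reals_Archimedean[of "min e f"] e f by auto
      then have n: "1 / real (Suc n) \<le> e" "1 / real (Suc n) \<le> f" by (auto simp: inverse_eq_divide)
      have "cell (1 / real (Suc n)) x \<times> cell (1 / real (Suc n)) y \<subseteq> S"
        using UV(4) e(2) f(2) subset_ball[OF n(1), of x] subset_ball[OF n(2), of y] unfolding cell_def by blast
      then have "(cell (1 / real (Suc n)) x, cell (1 / real (Suc n)) y) \<in> D n"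
        using z by (auto simp: D_def cells_def)
      moreover have "z \<in> cell (1 / real (Suc n)) x \<times> cell (1 / real (Suc n)) y"
        using z mem_cell_self by simp
      ultimately show "z \<in> (\<Union>n. \<Union>(B, C)\<in>D n. B \<times> C)" by blast
    next
      fix z assume "z \<in> (\<Union>n. \<Union>(B, C)\<in>D n. B \<times> C)"
      then obtain n B C where "(B, C) \<in> D n" "z \<in> B \<times> C" by auto
      then show "z \<in> S \<inter> X \<times> X"
        unfolding D_def by (auto simp: cells_def cell_def)
    qed
    ultimately show "(\<lambda>z. z) -` S \<inter> space ?P \<in> sets ?P"
      by (simp add: space_pair_measure space_restrict_space)
  qed
qed

end

subsection \<open>The transport cost as a sum over scales\<close>

text \<open>The radii are the levels of a tree of cells: \<open>dist_in_range\<close> lets the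
  telescoping sum start exactly at the index of a given distance, and \<open>dist_less_root\<close>
  puts all points into one cell at level 0.\<close>

locale ultrametric_scale = compact_ultrametric X
  for X :: "'a :: metric_space set" +
  fixes r :: "nat \<Rightarrow> real" and p :: real
  assumes r_pos: "0 < r k"
    and r_dec: "r (Suc k) < r k"
    and r_lim: "r \<longlonglongrightarrow> 0"
    and dist_in_range: "x \<in> X \<Longrightarrow> y \<in> X \<Longrightarrow> x \<noteq> y \<Longrightarrow> dist x y \<in> range r"
    and dist_less_root: "x \<in> X \<Longrightarrow> y \<in> X \<Longrightarrow> dist x y < r 0"
    and p_pos: "0 < p"
begin

lemma r_le_iff: "r j \<le> r k \<longleftrightarrow> k \<le> j"
proof -
  have "r j < r k" if "k < j" for j k
    using lift_Suc_mono_less[of "\<lambda>k. - r k", OF _ that] r_dec by simp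
  then show ?thesis by (metis linorder_not_less order.order_iff_strict)
qed

text \<open>The charge for separation at scale \<open>k\<close>: a pair at distance
  \<open>r m\<close> pays \<open>w k\<close> for every \<open>k \<ge> m\<close>, and these charges
  add up to \<open>r m powr p\<close>.\<close>

definition w :: "nat \<Rightarrow> real"
  where "w k = r k powr p - r (Suc k) powr p"

lemma w_nonneg: "0 \<le> w k"
  unfolding w_def diff_ge_0_iff_ge
  by (intro powr_mono2 less_imp_le p_pos r_pos r_dec)

lemma sum_w: "m \<le> n \<Longrightarrow> (\<Sum>k=m..<n. w k) = r m powr p - r n powr p"
  unfolding w_def using sum_Suc_diff'[of m n "\<lambda>k. - (r k powr p)"] by simp

lemma r_powr_lim: "(\<lambda>k. r k powr p) \<longlonglongrightarrow> 0"
  by (intro tendsto_zero_powrI[OF r_lim tendsto_const _ p_pos] always_eventually allI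
      less_imp_le r_pos)

text \<open>The cost is a telescoping sum over the scales below the distance; cutting it off at level \<open>K\<close>
  costs at most \<open>r K powr p\<close>.\<close>

lemma truncated_cost:
  assumes "x \<in> X" "y \<in> X"
  shows "(\<Sum>k<K. w k * of_bool (r k \<le> dist x y)) \<le> dist x y powr p"
    and "dist x y powr p \<le> (\<Sum>k<K. w k * of_bool (r k \<le> dist x y)) + r K powr p"
proof -
  have *: "(\<Sum>k<K. w k * of_bool (r k \<le> dist x y)) \<le> dist x y powr p \<and>
    dist x y powr p \<le> (\<Sum>k<K. w k * of_bool (r k \<le> dist x y)) + r K powr p"
  proof (cases "x = y")
    case True
    then have "(\<Sum>k<K. w k * of_bool (r k \<le> dist x y)) = 0"
      using r_pos by (intro sum.neutral) (auto simp: not_le)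
    then show ?thesis using True by simp
  next
    case False
    then obtain m where m: "dist x y = r m" using dist_in_range assms by blast
    \<comment> \<open>Exactly the scales from \<open>m\<close> on are charged. If
      \<open>K < m\<close> the sum is empty and the distance is itself below
      \<open>r K\<close>.\<close>
    have "(\<Sum>k<K. w k * of_bool (r k \<le> dist x y)) = (\<Sum>k=m..<K. w k)"
      unfolding m r_le_iff by (rule sum.mono_neutral_cong_right) auto
    also have "\<dots> = (if m \<le> K then r m powr p - r K powr p else 0)"
      using sum_w by auto
    finally show ?thesis
      using r_le_iff[of m K] r_pos[of m] p_pos unfolding m by (auto intro!: powr_mono2)
  qed
  show "(\<Sum>k<K. w k * of_bool (r k \<le> dist x y)) \<le> dist x y powr p"
    and "dist x y powr p \<le> (\<Sum>k<K. w k * of_bool (r k \<le> dist x y)) + r K powr p"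
    using * by auto
qed

text \<open>For probability measures this is the total variation distance of \<open>\<mu>\<close>
  and \<open>\<nu>\<close> seen through the partition at level \<open>k\<close>.\<close>

definition gap :: "nat \<Rightarrow> 'a measure \<Rightarrow> 'a measure \<Rightarrow> real"
  where "gap k \<mu> \<nu> = (\<Sum>B\<in>cells (r k). \<bar>measure \<mu> B - measure \<nu> B\<bar>) / 2"

lemma sum_measure_cells:
  assumes "\<mu> \<in> prob_measures X"
  shows "(\<Sum>B\<in>cells (r k). measure \<mu> B) = 1"
proof -
  interpret prob_space \<mu> using assms by (simp add: prob_measures_def)
  have s: "sets \<mu> = sets (restrict_space borel X)" using assms by (simp add: prob_measures_def)
  have sp: "space \<mu> = X" using sets_eq_imp_space_eq[OF s] by (simp add: space_restrict_space)
  have "measure \<mu> (\<Union>B\<in>cells (r k). B) = (\<Sum>B\<in>cells (r k). measure \<mu> B)"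
    by (rule finite_measure_finite_Union)
      (use finite_cells r_pos disjoint_cells sets_cells s in auto)
  then show ?thesis using Union_cells[OF r_pos] prob_space sp by simp
qed

text \<open>Write \<open>min a b\<close> as \<open>(a + b - \<bar>a - b\<bar>) / 2\<close> and use
  that both measures have total mass 1. This form can be compared cell by cell with
  \<open>measure_far\<close>.\<close>

lemma gap_eq:
  assumes "\<mu> \<in> prob_measures X" "\<nu> \<in> prob_measures X"
  shows "gap k \<mu> \<nu> = 1 - (\<Sum>B\<in>cells (r k). min (measure \<mu> B) (measure \<nu> B))"
proof -
  have "(\<Sum>B\<in>cells (r k). min (measure \<mu> B) (measure \<nu> B)) =
      (\<Sum>B\<in>cells (r k). (measure \<mu> B + measure \<nu> B - \<bar>measure \<mu> B - measure \<nu> B\<bar>) / 2)"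
    by (rule sum.cong) auto
  also have "\<dots> = 1 - gap k \<mu> \<nu>"
    unfolding gap_def sum_divide_distrib[symmetric] sum_subtractf sum.distrib
      sum_measure_cells[OF assms(1)] sum_measure_cells[OF assms(2)] by simp
  finally show ?thesis by simp
qed

lemma gap_nonneg: "0 \<le> gap k \<mu> \<nu>"
  unfolding gap_def by (intro divide_nonneg_pos sum_nonneg) auto

definition far :: "nat \<Rightarrow> ('a \<times> 'a) set"
  where "far k = {z \<in> X \<times> X. r k \<le> dist (fst z) (snd z)}"

section \<open>Mass moved and cost paid by a fixed coupling\<close>

context
  fixes \<mu> \<nu> \<gamma>
  assumes \<gamma>: "\<gamma> \<in> couplings X \<mu> \<nu>"
begin

lemma prob_space_coupling: "prob_space \<gamma>"
  and sets_coupling: "sets \<gamma> = sets (restrict_space borel (X \<times> X))"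
  and fst_coupling: "distr \<gamma> (restrict_space borel X) fst = \<mu>"
  and snd_coupling: "distr \<gamma> (restrict_space borel X) snd = \<nu>"
  using \<gamma> by (auto simp: couplings_def prob_measures_def)

interpretation prob_space \<gamma> by (rule prob_space_coupling)

lemma space_coupling: "space \<gamma> = X \<times> X"
  using sets_eq_imp_space_eq[OF sets_coupling] by (simp add: space_restrict_space)

lemma borel_measurable_coupling:
  "continuous_on (X \<times> X) f \<Longrightarrow> f \<in> borel_measurable \<gamma>"
  unfolding measurable_cong_sets[OF sets_coupling refl]
  by (rule borel_measurable_continuous_on_restrict)

lemma dist_measurable_coupling: "(\<lambda>z. dist (fst z) (snd z)) \<in> borel_measurable \<gamma>"
  by (intro borel_measurable_coupling continuous_intros)

lemma far_in_sets: "far k \<in> sets \<gamma>"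
proof -
  note dist_measurable_coupling[measurable]
  have "{z \<in> space \<gamma>. r k \<le> dist (fst z) (snd z)} \<in> sets \<gamma>" by measurable
  then show ?thesis by (simp add: far_def space_coupling)
qed

lemma Times_cells_in_sets: "B \<in> cells (r k) \<Longrightarrow> B \<times> B \<in> sets \<gamma>"
proof -
  assume "B \<in> cells (r k)"
  then obtain x where "B = X \<inter> ball x (r k)" by (auto simp: cells_def cell_def)
  then have "B \<times> B = (X \<times> X) \<inter> (ball x (r k) \<times> ball x (r k))" by auto
  moreover have "ball x (r k) \<times> ball x (r k) \<in> sets borel" by (intro borel_Times) auto
  ultimately show ?thesis by (simp add: sets_coupling sets_restrict_space)
qed

text \<open>Two points are closer than \<open>r k\<close> exactly when they share a cell, so
  \<open>far k\<close> is the complement of the disjoint union of the squares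
  \<open>B \<times> B\<close>.\<close>

lemma measure_far: "measure \<gamma> (far k) = 1 - (\<Sum>B\<in>cells (r k). measure \<gamma> (B \<times> B))"
proof -
  have "(\<Union>B\<in>cells (r k). B \<times> B) = {z \<in> X \<times> X. dist (fst z) (snd z) < r k}"
  proof (intro equalityI subsetI)
    fix z assume "z \<in> (\<Union>B\<in>cells (r k). B \<times> B)"
    then obtain B where B: "B \<in> cells (r k)" "fst z \<in> B" "snd z \<in> B" by auto
    note m = mem_cells[OF B(1) B(2) r_pos] mem_cells[OF B(1) B(3) r_pos]
    have "cell (r k) (fst z) = cell (r k) (snd z)" using m by simp
    then show "z \<in> {z \<in> X \<times> X. dist (fst z) (snd z) < r k}"
      using cell_eq_iff[OF m(1) m(3) r_pos] m by (auto simp: mem_Times_iff)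
  next
    fix z assume "z \<in> {z \<in> X \<times> X. dist (fst z) (snd z) < r k}"
    then have "cell (r k) (fst z) \<in> cells (r k)" "fst z \<in> cell (r k) (fst z)" "snd z \<in> cell (r k) (fst z)"
      using r_pos by (auto simp: cells_def cell_def)
    then show "z \<in> (\<Union>B\<in>cells (r k). B \<times> B)"
      by (metis UN_I mem_Times_iff)
  qed
  then have eq: "far k = space \<gamma> - (\<Union>B\<in>cells (r k). B \<times> B)"
    by (auto simp: far_def space_coupling)
  have "measure \<gamma> (\<Union>B\<in>cells (r k). B \<times> B) = (\<Sum>B\<in>cells (r k). measure \<gamma> (B \<times> B))"
    using disjoint_cells[OF r_pos, of k]
    by (intro finite_measure_finite_Union)
      (auto simp: disjoint_family_on_def Times_cells_in_sets finite_cells r_pos)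
  then show ?thesis
    unfolding eq by (subst prob_compl) (auto intro!: Times_cells_in_sets finite_cells r_pos)
qed

text \<open>The square \<open>B \<times> B\<close> lies in the preimage of \<open>B\<close> under
  either projection, and the marginals give the masses of these preimages.\<close>

lemma measure_Times_cells_le:
  assumes "B \<in> cells (r k)"
  shows "measure \<gamma> (B \<times> B) \<le> min (measure \<mu> B) (measure \<nu> B)"
proof -
  have B: "B \<in> sets (restrict_space borel X)" using assms by (rule sets_cells)
  then have BX: "B \<subseteq> X" using sets.sets_into_space by (fastforce simp: space_restrict_space)
  have m: "fst \<in> \<gamma> \<rightarrow>\<^sub>M restrict_space borel X" "snd \<in> \<gamma> \<rightarrow>\<^sub>M restrict_space borel X"
    unfolding measurable_cong_sets[OF sets_coupling refl]
    by (auto intro!: measurable_restrict_space3 borel_measurable_continuous_onI continuous_intros)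
  have "measure \<mu> B = measure \<gamma> (fst -` B \<inter> space \<gamma>)"
    by (subst fst_coupling[symmetric]) (rule measure_distr[OF m(1) B])
  moreover have "measure \<nu> B = measure \<gamma> (snd -` B \<inter> space \<gamma>)"
    by (subst snd_coupling[symmetric]) (rule measure_distr[OF m(2) B])
  moreover have "measure \<gamma> (B \<times> B) \<le> measure \<gamma> (fst -` B \<inter> space \<gamma>)"
    "measure \<gamma> (B \<times> B) \<le> measure \<gamma> (snd -` B \<inter> space \<gamma>)"
    using measurable_sets[OF m(1) B] measurable_sets[OF m(2) B] BX
    by (auto intro!: finite_measure_mono simp: space_coupling)
  ultimately show ?thesis by simp
qed

text \<open>Integrate \<open>truncated_cost\<close> against \<open>\<gamma>\<close>; the cost is
  integrable because it is measurable and bounded by \<open>r 0 powr p\<close>.\<close>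

lemma transport_cost_bounds:
  shows "(\<Sum>k<K. w k * measure \<gamma> (far k)) \<le> (\<integral>(a, b). dist a b powr p \<partial>\<gamma>)"
    and "(\<integral>(a, b). dist a b powr p \<partial>\<gamma>) \<le> (\<Sum>k<K. w k * measure \<gamma> (far k)) + r K powr p"
proof -
  let ?c = "\<lambda>z. dist (fst z) (snd z) powr p"
  let ?t = "\<lambda>z. \<Sum>k<K. w k * indicator (far k) z"
  note dist_measurable_coupling[measurable]
  have "?c \<in> borel_measurable \<gamma>" by measurable
  moreover have "norm (?c z) \<le> r 0 powr p" if "z \<in> space \<gamma>" for z
    using that dist_less_root[of "fst z" "snd z"] p_pos
    by (auto simp: space_coupling mem_Times_iff intro!: powr_mono2)
  ultimately have c: "integrable \<gamma> ?c"
    by (intro integrable_const_bound[of _ "r 0 powr p"] AE_I2)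
  have t: "integrable \<gamma> ?t"
    by (intro Bochner_Integration.integrable_sum integrable_mult_right integrable_real_indicator far_in_sets)
      (simp add: emeasure_eq_measure)
  have it: "integral\<^sup>L \<gamma> ?t = (\<Sum>k<K. w k * measure \<gamma> (far k))"
    using far_in_sets sets.sets_into_space[OF far_in_sets]
    by (subst Bochner_Integration.integral_sum)
      (auto simp: Int_absorb2 emeasure_eq_measure intro!: integrable_real_indicator)
  have ind: "indicator (far k) z = (of_bool (r k \<le> dist (fst z) (snd z)) :: real)" if "z \<in> X \<times> X" for k z
    using that by (auto simp: far_def)
  have "integral\<^sup>L \<gamma> ?t \<le> integral\<^sup>L \<gamma> ?c"
    by (rule integral_mono[OF t c])
      (use truncated_cost(1) in \<open>auto simp: space_coupling ind\<close>)
  moreover have "integral\<^sup>L \<gamma> ?c \<le> integral\<^sup>L \<gamma> (\<lambda>z. ?t z + r K powr p)"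
    by (rule integral_mono[OF c])
      (use truncated_cost(2) t in \<open>auto simp: space_coupling ind\<close>)
  moreover have "integral\<^sup>L \<gamma> (\<lambda>z. ?t z + r K powr p) = integral\<^sup>L \<gamma> ?t + r K powr p"
    using t by (subst Bochner_Integration.integral_add) (auto simp: prob_space)
  ultimately show "(\<Sum>k<K. w k * measure \<gamma> (far k)) \<le> (\<integral>(a, b). dist a b powr p \<partial>\<gamma>)"
    and "(\<integral>(a, b). dist a b powr p \<partial>\<gamma>) \<le> (\<Sum>k<K. w k * measure \<gamma> (far k)) + r K powr p"
    unfolding it case_prod_beta' by linarith+
qed

end

section \<open>Near-optimal couplings and the value of the transport infimum\<close>

text \<open>The cells of level \<open>K\<close> are the leaves of a finite tree whose inner nodes
  are the coarser cells. A hierarchical plan between the leaves, realised as a coupling, keeps as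
  much mass as possible inside every cell of every level up to \<open>K\<close> at once.\<close>

lemma ex_near_optimal_coupling:
  assumes \<mu>: "\<mu> \<in> prob_measures X" and \<nu>: "\<nu> \<in> prob_measures X"
  shows "\<exists>\<gamma>\<in>couplings X \<mu> \<nu>. \<forall>k\<le>K. \<forall>B\<in>cells (r k).
    min (measure \<mu> B) (measure \<nu> B) \<le> measure \<gamma> (B \<times> B)"
proof -
  let ?R = "restrict_space borel X"
  interpret \<mu>: prob_space \<mu> using \<mu> by (simp add: prob_measures_def)
  interpret \<nu>: prob_space \<nu> using \<nu> by (simp add: prob_measures_def)
  have s: "sets \<mu> = sets ?R" "sets \<nu> = sets ?R"
    using \<mu> \<nu> by (auto simp: prob_measures_def)
  have sp: "space \<mu> = X" "space \<nu> = X"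
    using s[THEN sets_eq_imp_space_eq] by (simp_all add: space_restrict_space)
  \<comment> \<open>One centre is chosen per leaf. Leaves are then indexed by points, and the
    ancestor of leaf \<open>i\<close> at level \<open>k\<close> is simply
    \<open>cell (r k) i\<close>.\<close>
  have "\<exists>J. J \<subseteq> X \<and> inj_on (cell (r K)) J \<and> cells (r K) = cell (r K) ` J"
    using subset_image_inj[of "cells (r K)" "cell (r K)" X] by (simp add: cells_def)
  then obtain J where J: "J \<subseteq> X" "inj_on (cell (r K)) J" "cells (r K) = cell (r K) ` J" by blast
  have fin: "finite J"
    using finite_cells[OF r_pos, of K] J finite_imageD by metis
  define B where "B = cell (r K)"
  have BR: "B i \<in> sets ?R" if "i \<in> J" for i
    by (rule sets_cells[of _ "r K"]) (use that J(3) in \<open>simp add: B_def\<close>)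
  have disj: "disjoint_family_on B J"
    unfolding disjoint_family_on_def
  proof (intro ballI impI)
    fix i j assume "i \<in> J" "j \<in> J" "i \<noteq> j"
    then have "B i \<noteq> B j" "B i \<in> cells (r K)" "B j \<in> cells (r K)"
      using J(2,3) by (auto simp: B_def inj_on_def)
    then show "B i \<inter> B j = {}"
      using disjoint_cells[OF r_pos, of K] unfolding disjoint_family_on_def by blast
  qed
  have cover: "X \<subseteq> (\<Union>i\<in>J. B i)"
    using Union_cells[OF r_pos, of K] unfolding J(3) B_def by simp
  have part\<mu>: "measure \<mu> A = (\<Sum>i\<in>J. measure \<mu> (A \<inter> B i))" if "A \<in> sets ?R" for A
    by (rule measure_eq_sum_partition[OF \<mu>.finite_measure_axioms fin _ disj])
      (use BR that s sp cover in auto)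
  have part\<nu>: "measure \<nu> A = (\<Sum>i\<in>J. measure \<nu> (A \<inter> B i))" if "A \<in> sets ?R" for A
    by (rule measure_eq_sum_partition[OF \<nu>.finite_measure_axioms fin _ disj])
      (use BR that s sp cover in auto)
  define q where "q k = cell (r k)" for k
  have refine: "\<forall>k. \<forall>i\<in>J. \<forall>j\<in>J. q (Suc k) i = q (Suc k) j \<longrightarrow> q k i = q k j"
  proof (intro allI ballI impI)
    fix k i j assume ij: "i \<in> J" "j \<in> J" and eq: "q (Suc k) i = q (Suc k) j"
    have X: "i \<in> X" "j \<in> X" using ij J(1) by auto
    show "q k i = q k j"
      using eq r_dec[of k] unfolding q_def cell_eq_iff[OF X r_pos] by linarith
  qed
  have root: "\<forall>i\<in>J. \<forall>j\<in>J. q 0 i = q 0 j"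
  proof (intro ballI)
    fix i j assume "i \<in> J" "j \<in> J"
    then have X: "i \<in> X" "j \<in> X" using J(1) by auto
    show "q 0 i = q 0 j" unfolding q_def cell_eq_iff[OF X r_pos] by (rule dist_less_root[OF X])
  qed
  have sX: "X \<in> sets ?R"
    using sets.top[of ?R] by (simp add: space_restrict_space)
  have BX: "X \<inter> B i = B i" for i by (auto simp: B_def cell_def)
  have tot: "(\<Sum>i\<in>J. measure \<mu> (B i)) = (\<Sum>i\<in>J. measure \<nu> (B i))"
    using part\<mu>[OF sX] part\<nu>[OF sX] \<mu>.prob_space \<nu>.prob_space by (simp add: BX sp)
  have "\<exists>\<pi>. (\<forall>i\<in>J. \<forall>j\<in>J. 0 \<le> \<pi> i j) \<and>
    (\<forall>i\<in>J. (\<Sum>j\<in>J. \<pi> i j) = measure \<mu> (B i)) \<and>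
    (\<forall>j\<in>J. (\<Sum>i\<in>J. \<pi> i j) = measure \<nu> (B j)) \<and>
    (\<forall>l\<le>K. \<forall>b. min (\<Sum>i | i \<in> J \<and> q l i = b. measure \<mu> (B i)) (\<Sum>j | j \<in> J \<and> q l j = b. measure \<nu> (B j))
           \<le> (\<Sum>i | i \<in> J \<and> q l i = b. \<Sum>j | j \<in> J \<and> q l j = b. \<pi> i j))"
    by (rule ex_hierarchical_plan[OF fin _ _ refine root tot]) simp_all
  then obtain \<pi> where pos: "\<forall>i\<in>J. \<forall>j\<in>J. 0 \<le> \<pi> i j"
    and row: "\<forall>i\<in>J. (\<Sum>j\<in>J. \<pi> i j) = measure \<mu> (B i)"
    and col: "\<forall>j\<in>J. (\<Sum>i\<in>J. \<pi> i j) = measure \<nu> (B j)"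
    and blk: "\<forall>l\<le>K. \<forall>b.
      min (\<Sum>i | i \<in> J \<and> q l i = b. measure \<mu> (B i)) (\<Sum>j | j \<in> J \<and> q l j = b. measure \<nu> (B j))
           \<le> (\<Sum>i | i \<in> J \<and> q l i = b. \<Sum>j | j \<in> J \<and> q l j = b. \<pi> i j)"
    by (elim exE conjE) (rule that)
  have BR': "\<forall>i\<in>J. B i \<in> sets ?R" using BR by blast
  obtain \<gamma> where \<gamma>: "\<gamma> \<in> couplings X \<mu> \<nu>"
    and m\<gamma>: "\<forall>A\<in>sets ?R. \<forall>C\<in>sets ?R.
      measure \<gamma> (A \<times> C) = (\<Sum>i\<in>J. \<Sum>j\<in>J. \<pi> i j *
        (measure \<mu> (A \<inter> B i) / measure \<mu> (B i)) * (measure \<nu> (C \<inter> B j) / measure \<nu> (B j)))"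
    using ex_coupling_of_plan[OF measurable_id_pair \<mu> \<nu> fin BR' disj cover pos row col]
    by (elim bexE) (rule that)
  note pos = pos[rule_format] and row = row[rule_format] and col = col[rule_format]
  \<comment> \<open>Null leaves carry no plan mass, so in the formula for \<open>\<gamma>\<close>
    the quotients \<open>0 / 0\<close> only multiply zero entries.\<close>
  have \<pi>0: "\<pi> i j = 0" if ij: "i \<in> J" "j \<in> J" and 0: "measure \<mu> (B i) = 0 \<or> measure \<nu> (B j) = 0" for i j
  proof -
    have "\<pi> i j \<le> measure \<mu> (B i)"
      unfolding row[OF ij(1), symmetric] by (rule member_le_sum) (use ij pos fin in auto)
    moreover have "\<pi> i j \<le> measure \<nu> (B j)"
      unfolding col[OF ij(2), symmetric]
      by (rule member_le_sum[of i J "\<lambda>i. \<pi> i j"]) (use ij pos fin in auto)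
    ultimately show ?thesis using 0 pos[OF ij] by auto
  qed
  have "min (measure \<mu> b) (measure \<nu> b) \<le> measure \<gamma> (b \<times> b)" if k: "k \<le> K" and b: "b \<in> cells (r k)" for k b
  proof -
    have bR: "b \<in> sets ?R" using b by (rule sets_cells)
    \<comment> \<open>As \<open>k \<le> K\<close>, each leaf is contained in its level
      \<open>k\<close> ancestor, and distinct cells of level \<open>k\<close> are disjoint.\<close>
    have bB: "b \<inter> B i = (if q k i = b then B i else {})" if i: "i \<in> J" for i
    proof -
      have iX: "i \<in> X" using i J by auto
      have sub: "B i \<subseteq> q k i"
        unfolding B_def q_def cell_def using k r_le_iff[of K k] by auto
      have "q k i \<in> cells (r k)" using iX by (simp add: q_def cells_def)
      then have "q k i \<inter> b = {}" if "q k i \<noteq> b"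
        using that b disjoint_cells[OF r_pos, of k] unfolding disjoint_family_on_def by blast
      then show ?thesis using sub by auto
    qed
    let ?Jb = "{i. i \<in> J \<and> q k i = b}"
    have sub: "(\<Sum>i\<in>J. f (b \<inter> B i)) = (\<Sum>i\<in>?Jb. f (B i))" if "f {} = 0" for f :: "'a set \<Rightarrow> real"
      by (rule sum.mono_neutral_cong_right) (use fin that bB in auto)
    have "measure \<gamma> (b \<times> b) = (\<Sum>i\<in>J. \<Sum>j\<in>J. if q k i = b \<and> q k j = b then \<pi> i j else 0)"
      unfolding m\<gamma>[THEN bspec, OF bR, THEN bspec, OF bR]
    proof (intro sum.cong refl)
      fix i j assume ij: "i \<in> J" "j \<in> J"
      show "\<pi> i j * (measure \<mu> (b \<inter> B i) / measure \<mu> (B i)) * (measure \<nu> (b \<inter> B j) / measure \<nu> (B j)) =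
          (if q k i = b \<and> q k j = b then \<pi> i j else 0)"
        unfolding bB[OF ij(1)] bB[OF ij(2)] using \<pi>0[OF ij] by auto
    qed
    also have "\<dots> = (\<Sum>i\<in>J. if q k i = b then \<Sum>j\<in>?Jb. \<pi> i j else 0)"
      by (intro sum.cong refl) (simp add: sum.inter_filter[OF fin])
    also have "\<dots> = (\<Sum>i\<in>?Jb. \<Sum>j\<in>?Jb. \<pi> i j)"
      by (rule sum.inter_filter[OF fin, symmetric])
    finally have "measure \<gamma> (b \<times> b) = (\<Sum>i\<in>?Jb. \<Sum>j\<in>?Jb. \<pi> i j)" .
    then show ?thesis
      using blk[THEN spec, THEN mp, OF k, THEN spec, of b]
      unfolding part\<mu>[OF bR] part\<nu>[OF bR] sub[of "measure \<mu>", OF measure_empty]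
        sub[of "measure \<nu>", OF measure_empty] by simp
  qed
  then show ?thesis using \<gamma> by blast
qed

text \<open>Every coupling moves at least \<open>gap k\<close> at each scale, so the partial sums
  stay below the infimum. A coupling that is optimal at the first \<open>K\<close> scales shows that
  they miss it by at most \<open>r K powr p\<close>, which tends to 0.\<close>

lemma transport_cost_sums:
  assumes \<mu>: "\<mu> \<in> prob_measures X" and \<nu>: "\<nu> \<in> prob_measures X"
  shows "(\<lambda>k. w k * gap k \<mu> \<nu>) sums (INF \<gamma>\<in>couplings X \<mu> \<nu>. \<integral>(a, b). dist a b powr p \<partial>\<gamma>)"
proof -
  let ?cost = "\<lambda>\<gamma>. \<integral>(a, b). dist a b powr p \<partial>\<gamma>"
  define I where "I = (INF \<gamma>\<in>couplings X \<mu> \<nu>. ?cost \<gamma>)"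
  have lower: "(\<Sum>k<K. w k * gap k \<mu> \<nu>) \<le> ?cost \<gamma>" if \<gamma>: "\<gamma> \<in> couplings X \<mu> \<nu>" for \<gamma> K
  proof -
    have "gap k \<mu> \<nu> \<le> measure \<gamma> (far k)" for k
      unfolding gap_eq[OF \<mu> \<nu>] measure_far[OF \<gamma>]
      by (intro diff_left_mono sum_mono measure_Times_cells_le[OF \<gamma>])
    then have "(\<Sum>k<K. w k * gap k \<mu> \<nu>) \<le> (\<Sum>k<K. w k * measure \<gamma> (far k))"
      by (intro sum_mono mult_left_mono w_nonneg)
    also have "\<dots> \<le> ?cost \<gamma>" by (rule transport_cost_bounds(1)[OF \<gamma>])
    finally show ?thesis .
  qed
  have upper: "\<exists>\<gamma>\<in>couplings X \<mu> \<nu>. ?cost \<gamma> \<le> (\<Sum>k<K. w k * gap k \<mu> \<nu>) + r K powr p" for K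
  proof -
    obtain \<gamma> where \<gamma>: "\<gamma> \<in> couplings X \<mu> \<nu>"
      and near: "\<forall>k\<le>K. \<forall>B\<in>cells (r k). min (measure \<mu> B) (measure \<nu> B) \<le> measure \<gamma> (B \<times> B)"
      using ex_near_optimal_coupling[OF \<mu> \<nu>, of K] by blast
    have far: "measure \<gamma> (far k) \<le> gap k \<mu> \<nu>" if "k < K" for k
      unfolding gap_eq[OF \<mu> \<nu>] measure_far[OF \<gamma>]
      by (intro diff_left_mono sum_mono near[rule_format]) (use that in auto)
    have "?cost \<gamma> \<le> (\<Sum>k<K. w k * measure \<gamma> (far k)) + r K powr p"
      by (rule transport_cost_bounds(2)[OF \<gamma>])
    also have "(\<Sum>k<K. w k * measure \<gamma> (far k)) \<le> (\<Sum>k<K. w k * gap k \<mu> \<nu>)"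
      by (intro sum_mono mult_left_mono w_nonneg far) simp
    finally show ?thesis using \<gamma> by auto
  qed
  have ne: "couplings X \<mu> \<nu> \<noteq> {}" using upper by blast
  have bdd: "bdd_below (?cost ` couplings X \<mu> \<nu>)"
    using lower by (intro bdd_belowI2)
  have le: "(\<Sum>k<K. w k * gap k \<mu> \<nu>) \<le> I" for K
    unfolding I_def by (rule cINF_greatest[OF ne lower])
  have ge: "I - r K powr p \<le> (\<Sum>k<K. w k * gap k \<mu> \<nu>)" for K
    using upper[of K] cINF_lower[OF bdd] unfolding I_def by fastforce
  have lim: "(\<lambda>K. I - r K powr p) \<longlonglongrightarrow> I"
    using tendsto_diff[OF tendsto_const r_powr_lim, of I] by simp
  have "(\<lambda>k. w k * gap k \<mu> \<nu>) sums I"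
    unfolding sums_def
  proof (rule tendsto_sandwich[OF _ _ lim tendsto_const])
    show "\<forall>\<^sub>F K in sequentially. I - r K powr p \<le> (\<Sum>k<K. w k * gap k \<mu> \<nu>)"
      by (rule always_eventually) (rule allI, rule ge)
    show "\<forall>\<^sub>F K in sequentially. (\<Sum>k<K. w k * gap k \<mu> \<nu>) \<le> I"
      by (rule always_eventually) (rule allI, rule le)
  qed
  then show ?thesis by (simp only: I_def)
qed

end

subsection \<open>The embedding\<close>

context ultrametric_scale
begin

text \<open>The index set of the coordinates. The level is kept as a tag because the same set may be
  a cell at several levels, each with its own weight.\<close>

definition nodes :: "(nat \<times> 'a set) set"
  where "nodes = (SIGMA k:UNIV. cells (r k))"

text \<open>Each level has finitely many cells, and at least one since \<open>X\<close> is nonempty;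
  hence \<open>nodes\<close> is countably infinite and can be numbered by all of
  \<open>nat\<close>.\<close>

lemma bij_nodes:
  assumes "X \<noteq> {}"
  shows "bij_betw (from_nat_into nodes) UNIV nodes"
proof (rule bij_betw_from_nat_into)
  show "countable nodes"
    unfolding nodes_def by (rule countable_SIGMA) (simp_all add: countable_finite finite_cells r_pos)
  obtain x where "x \<in> X" using assms by blast
  then have "(k, cell (r k) x) \<in> nodes" for k by (simp add: nodes_def cells_def)
  then have "fst ` nodes = UNIV" by (metis UNIV_eq_I fst_conv image_eqI)
  then show "infinite nodes" using finite_imageI[of nodes fst] by auto
qed

text \<open>Nonnegativity makes the double series over levels and cells absolutely summable on
  \<open>nodes\<close>, so its value does not depend on the chosen numbering.\<close>

lemma sums_nodes:
  fixes f :: "nat \<Rightarrow> 'a set \<Rightarrow> real"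
  assumes "X \<noteq> {}" and nonneg: "\<And>k B. 0 \<le> f k B"
    and sums: "(\<lambda>k. \<Sum>B\<in>cells (r k). f k B) sums s"
  shows "(\<lambda>n. case from_nat_into nodes n of (k, B) \<Rightarrow> f k B) sums s"
proof -
  let ?f = "\<lambda>(k, B). f k B"
  have inner: "((\<lambda>B. ?f (k, B)) has_sum (\<Sum>B\<in>cells (r k). f k B)) (cells (r k))" for k
    using has_sum_finite[OF finite_cells[OF r_pos], of "f k" k] by simp
  have outer: "((\<lambda>k. \<Sum>B\<in>cells (r k). f k B) has_sum s) UNIV"
    by (rule sums_nonneg_imp_has_sum[OF sums]) (simp add: nonneg sum_nonneg)
  have "(\<lambda>z. norm (?f z)) summable_on nodes"
    unfolding nodes_def Infinite_Sum.abs_summable_on_Sigma_iff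
  proof (intro conjI ballI)
    show "(\<lambda>B. norm (?f (k, B))) summable_on cells (r k)" for k
      using finite_cells[OF r_pos] by (rule summable_on_finite)
    have "(\<lambda>k. \<Sum>B\<in>cells (r k). f k B) summable_on UNIV" using outer by (rule has_sum_imp_summable)
    then show "(\<lambda>k. norm (\<Sum>\<^sub>\<infinity>B\<in>cells (r k). norm (?f (k, B)))) summable_on UNIV"
      using nonneg finite_cells[OF r_pos] by (simp add: sum_nonneg)
  qed
  then have "?f summable_on nodes" by (rule abs_summable_summable)
  then have "(?f has_sum s) nodes"
    using has_sum_SigmaI[OF inner outer] unfolding nodes_def by blast
  then have "((\<lambda>n. ?f (from_nat_into nodes n)) has_sum s) UNIV"
    by (subst has_sum_reindex_bij_betw[OF bij_nodes[OF assms(1)]])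
  then show ?thesis by (rule has_sum_imp_sums)
qed

definition embed_coord :: "'a measure \<Rightarrow> nat \<Rightarrow> real"
  where "embed_coord \<mu> n = (case from_nat_into nodes n of (k, B) \<Rightarrow> w k / 2 * measure \<mu> B)"

definition embed :: "'a measure \<Rightarrow> ell1"
  where "embed \<mu> = Abs_ell1 (embed_coord \<mu>)"

text \<open>This is the summability required by \<open>Abs_ell1\<close>: the cells of level
  \<open>k\<close> contribute \<open>w k / 2\<close> in total, and these telescope to
  \<open>r 0 powr p / 2\<close>.\<close>

lemma coord_embed:
  assumes "X \<noteq> {}" "\<mu> \<in> prob_measures X"
  shows "coord (embed \<mu>) = embed_coord \<mu>"
proof -
  have "(\<lambda>k. \<Sum>B\<in>cells (r k). w k / 2 * measure \<mu> B) = (\<lambda>k. w k / 2)"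
    unfolding sum_distrib_left[symmetric] sum_measure_cells[OF assms(2)] by simp
  moreover have "(\<lambda>k. w k / 2) sums (r 0 powr p / 2)"
    using sums_divide[OF telescope_sums'[OF r_powr_lim], of 2] by (simp add: w_def)
  ultimately have "embed_coord \<mu> sums (r 0 powr p / 2)"
    unfolding embed_coord_def
    by (intro sums_nodes assms) (simp_all add: w_nonneg)
  moreover have "\<bar>embed_coord \<mu> n\<bar> = embed_coord \<mu> n" for n
    by (simp add: embed_coord_def w_nonneg split: prod.split)
  ultimately show ?thesis
    unfolding embed_def by (intro Abs_ell1_inverse) (simp add: sums_iff)
qed

text \<open>Each coordinate is a fixed multiple of the mass of one measurable cell, hence affine in
  the measure.\<close>

lemma embed_mix_measure:
  assumes "X \<noteq> {}" and \<mu>: "\<mu> \<in> prob_measures X" and \<nu>: "\<nu> \<in> prob_measures X"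
    and t: "0 \<le> t" "t \<le> 1"
  shows "embed (mix_measure t \<mu> \<nu>) = t *\<^sub>R embed \<mu> + (1 - t) *\<^sub>R embed \<nu>"
proof -
  have s: "sets \<mu> = sets \<nu>" "sets \<mu> = sets (restrict_space borel X)"
    using \<mu> \<nu> by (auto simp: prob_measures_def)
  interpret \<mu>: prob_space \<mu> using \<mu> by (simp add: prob_measures_def)
  interpret \<nu>: prob_space \<nu> using \<nu> by (simp add: prob_measures_def)
  have mix: "measure (mix_measure t \<mu> \<nu>) B = t * measure \<mu> B + (1 - t) * measure \<nu> B"
    if "B \<in> sets \<mu>" for B
  proof -
    have "emeasure (mix_measure t \<mu> \<nu>) B = ennreal (t * measure \<mu> B + (1 - t) * measure \<nu> B)"
      unfolding emeasure_mix_measure[OF s(1) that] using t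
      by (simp add: \<mu>.emeasure_eq_measure \<nu>.emeasure_eq_measure ennreal_mult ennreal_plus)
    then show ?thesis using t by (intro measure_eq_emeasure_eq_ennreal) simp_all
  qed
  have "embed_coord (mix_measure t \<mu> \<nu>) n = t * embed_coord \<mu> n + (1 - t) * embed_coord \<nu> n" for n
  proof -
    obtain k B where kB: "from_nat_into nodes n = (k, B)" by fastforce
    have "from_nat_into nodes n \<in> nodes"
      using bij_betwE[OF bij_nodes[OF assms(1)]] by blast
    then have "B \<in> cells (r k)" unfolding kB by (simp add: nodes_def)
    then have "B \<in> sets \<mu>" unfolding s(2) by (rule sets_cells)
    moreover have "c * (t * a + (1 - t) * b) = t * (c * a) + (1 - t) * (c * b)" for a b c :: real
      by (simp add: algebra_simps)
    ultimately show ?thesis by (simp only: embed_coord_def kB prod.case mix)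
  qed
  then have "coord (embed (mix_measure t \<mu> \<nu>)) = coord (t *\<^sub>R embed \<mu> + (1 - t) *\<^sub>R embed \<nu>)"
    using coord_embed[OF assms(1) mix_measure_in_prob_measures[OF \<mu> \<nu> t]]
      coord_embed[OF assms(1) \<mu>] coord_embed[OF assms(1) \<nu>]
    by (simp add: plus_ell1.rep_eq scaleR_ell1.rep_eq fun_eq_iff)
  then show ?thesis by (simp add: coord_inject)
qed

text \<open>Grouped by level, the absolute coordinate differences sum to
  \<open>w k * gap k \<mu> \<nu>\<close>, the factor 1/2 being the one in \<open>gap\<close>. The
  series over \<open>k\<close> is the transport infimum.\<close>

lemma norm_embed_diff:
  assumes "X \<noteq> {}" and \<mu>: "\<mu> \<in> prob_measures X" and \<nu>: "\<nu> \<in> prob_measures X"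
  shows "norm (embed \<mu> - embed \<nu>) = wasserstein X p \<mu> \<nu> powr p"
proof -
  define I where "I = (INF \<gamma>\<in>couplings X \<mu> \<nu>. \<integral>(a, b). dist a b powr p \<partial>\<gamma>)"
  have I: "(\<lambda>k. w k * gap k \<mu> \<nu>) sums I"
    unfolding I_def by (rule transport_cost_sums[OF \<mu> \<nu>])
  \<comment> \<open>Nonnegativity is what lets the powers \<open>1 / p\<close> and \<open>p\<close>
    cancel, as \<open>powr\<close> does not return a negative base.\<close>
  have "I \<ge> 0"
    using suminf_nonneg[of "\<lambda>k. w k * gap k \<mu> \<nu>"] I w_nonneg gap_nonneg by (simp add: sums_iff)
  then have W: "wasserstein X p \<mu> \<nu> powr p = I"
    using p_pos by (simp add: wasserstein_def I_def[symmetric] powr_powr)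
  have "(\<lambda>k. \<Sum>B\<in>cells (r k). w k / 2 * \<bar>measure \<mu> B - measure \<nu> B\<bar>) = (\<lambda>k. w k * gap k \<mu> \<nu>)"
    unfolding gap_def sum_distrib_left[symmetric] by simp
  then have sums: "(\<lambda>n. case from_nat_into nodes n of (k, B) \<Rightarrow>
      w k / 2 * \<bar>measure \<mu> B - measure \<nu> B\<bar>) sums I"
    using I by (intro sums_nodes assms(1)) (simp_all add: w_nonneg)
  have "\<bar>coord (embed \<mu> - embed \<nu>) n\<bar> =
      (case from_nat_into nodes n of (k, B) \<Rightarrow> w k / 2 * \<bar>measure \<mu> B - measure \<nu> B\<bar>)" for n
  proof -
    obtain k B where kB: "from_nat_into nodes n = (k, B)" by fastforce
    show ?thesis
      unfolding minus_ell1.rep_eq coord_embed[OF assms(1) \<mu>] coord_embed[OF assms(1) \<nu>]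
        embed_coord_def kB prod.case right_diff_distrib[symmetric] abs_mult
      using w_nonneg[of k] by simp
  qed
  then have "norm (embed \<mu> - embed \<nu>) = I"
    using sums by (simp add: norm_ell1.rep_eq sums_iff)
  then show ?thesis using W by simp
qed

end

section \<open>Existence of a scale and assembly of the embedding\<close>

context compact_ultrametric
begin

text \<open>Adjoining \<open>diameter X + 1\<close> to the nonzero distances forces the first and
  largest radius to exceed every distance. The same \<open>r\<close> serves all exponents.\<close>

lemma ex_scale: "\<exists>r. \<forall>p>0. ultrametric_scale X r p"
proof -
  define V where "V = (\<lambda>(x, y). dist x y) ` (X \<times> X)"
  define U where "U = (V - {0}) \<union> {diameter X + 1}"
  have bdd: "bounded X" using compact by (rule compact_imp_bounded)
  have fin: "finite {u\<in>U. e \<le> u}" if "0 < e" for e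
    by (rule finite_subset[of _ "{d \<in> V. e \<le> d} \<union> {diameter X + 1}"])
      (use finite_dist_ge[OF that] in \<open>auto simp: U_def V_def\<close>)
  have pos: "0 < u" if "u \<in> U" for u
    using that diameter_ge_0[OF bdd] by (auto simp: U_def V_def)
  obtain r where r: "\<forall>k. 0 < r k" "\<forall>k. r (Suc k) < r k" "r \<longlonglongrightarrow> 0" "U \<subseteq> range r"
    using ex_decreasing_enumeration[of U, OF fin pos] by blast
  have range: "dist x y \<in> range r" if "x \<in> X" "y \<in> X" "x \<noteq> y" for x y
    using r(4) that by (force simp: U_def V_def)
  have root: "dist x y < r 0" if "x \<in> X" "y \<in> X" for x y
  proof -
    obtain k where "diameter X + 1 = r k" using r(4) by (auto simp: U_def)
    moreover have "decseq r" using r(2) by (intro decseq_SucI less_imp_le) blast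
    then have "r k \<le> r 0" by (simp add: decseqD)
    ultimately show ?thesis using diameter_bounded_bound[OF bdd that] by linarith
  qed
  have "ultrametric_scale X r p" if "0 < p" for p
  proof
    show "0 < r k" "r (Suc k) < r k" for k using r(1,2) by blast+
  qed (fact r(3) range root that)+
  then show ?thesis by blast
qed

end

theorem theorem1p1:
  fixes X :: "'a :: metric_space set" and p :: real
  assumes "compact X" and "ultrametric_on X" and "1 \<le> p"
  shows "\<exists>\<phi> :: 'a measure \<Rightarrow> ell1.
    convex (\<phi> ` prob_measures X) \<and>
    (\<forall>\<mu>\<in>prob_measures X. \<forall>\<nu>\<in>prob_measures X. \<forall>t\<in>{0..1}.
      \<phi> (mix_measure t \<mu> \<nu>) = t *\<^sub>R \<phi> \<mu> + (1 - t) *\<^sub>R \<phi> \<nu>) \<and>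
    (\<forall>\<mu>\<in>prob_measures X. \<forall>\<nu>\<in>prob_measures X.
      norm (\<phi> \<mu> - \<phi> \<nu>) = wasserstein X p \<mu> \<nu> powr p)"
proof (cases "X = {}")
  case True
  \<comment> \<open>The empty space carries no probability measure, so all claims are about the
    empty set.\<close>
  have False if "\<mu> \<in> prob_measures X" for \<mu>
  proof -
    have "space \<mu> = {}"
      using that True sets_eq_imp_space_eq[of \<mu> "restrict_space borel X"]
      by (simp add: prob_measures_def space_restrict_space)
    then show False using that prob_space.not_empty by (auto simp: prob_measures_def)
  qed
  then have "prob_measures X = {}" by blast
  then show ?thesis by simp
next
  case False
  interpret compact_ultrametric X by unfold_locales fact+
  have "0 < p" using assms(3) by simp
  then obtain r where "ultrametric_scale X r p" using ex_scale by blast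
  then interpret ultrametric_scale X r p .
  have "convex (embed ` prob_measures X)"
  \<comment> \<open>A convex combination of two image points is the image of the corresponding
    mixture, which is again a probability measure on \<open>X\<close>.\<close>
  proof (rule convexI)
    fix a b and u v :: real
    assume "a \<in> embed ` prob_measures X" "b \<in> embed ` prob_measures X"
      and uv: "0 \<le> u" "0 \<le> v" "u + v = 1"
    then obtain \<mu> \<nu> where ab: "\<mu> \<in> prob_measures X" "\<nu> \<in> prob_measures X" "a = embed \<mu>" "b = embed \<nu>"
      by blast
    have v: "v = 1 - u" and "u \<le> 1" using uv by auto
    then have "u *\<^sub>R a + v *\<^sub>R b = embed (mix_measure u \<mu> \<nu>)"
      using embed_mix_measure[OF False ab(1,2) uv(1)] ab by simp
    moreover have "mix_measure u \<mu> \<nu> \<in> prob_measures X"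
      using mix_measure_in_prob_measures[OF ab(1,2) uv(1) \<open>u \<le> 1\<close>] .
    ultimately show "u *\<^sub>R a + v *\<^sub>R b \<in> embed ` prob_measures X" by simp
  qed
  moreover have "embed (mix_measure t \<mu> \<nu>) = t *\<^sub>R embed \<mu> + (1 - t) *\<^sub>R embed \<nu>"
    if "\<mu> \<in> prob_measures X" "\<nu> \<in> prob_measures X" "t \<in> {0..1}" for \<mu> \<nu> t
    using embed_mix_measure[OF False] that by simp
  ultimately show ?thesis
    using norm_embed_diff[OF False] by (intro exI[of _ embed]) blast
qed

end
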